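(* Let $I_1, I_2$ be countable index sets and let $\mathcal{A}_1$ and $\mathcal{A}_2$ be solid involutive Banach algebras of complex matrices indexed by $I_1^2$ and $I_2^2$, respectively. Let $\mathcal{A} = \widetilde{\mathcal{A}}_1 \cap \widetilde{\mathcal{A}}_2$ be the associated space of rank-four tensors (as defined in the context) with the norm $\|A\|_{\mathcal{A}} = \max\{\|A\|_{\widetilde{\mathcal{A}}_1}, \|A\|_{\widetilde{\mathcal{A}}_2}\}$. Then $\mathcal{A}$, equipped with entrywise scalar multiplication and addition, with the doubly contracted tensor product $:$ as multiplication, with the adjoint $A\mapsto A^*$, $(A^* )_{i,k,l,j}=\overline{A_{j,l,k,i}}$, as involution, and with the norm $\|\cdot\|_{\mathcal{A}}$, is an involutive Banach algebra.
   Context: A Banach algebra of matrices indexed by $I^2$ is a linear space of complex matrices $(M_{i,j})_{(i,j)\in I^2}$ with a complete norm that is closed under matrix multiplication (the series defining the entries of products being convergent) and whose norm is submultiplicative; it need not be unital. It is involutive if it is closed under the conjugate transpose $M\mapsto M^*$ and $\|M^*\|=\|M\|$; more generally, an involutive Banach algebra is a Banach algebra with a conjugate-linear, product-reversing, isometric involution. A Banach algebra of matrices is called solid if, whenever $M$ belongs to it and $N=(N_{i,j})_{(i,j)\in I^2}$ satisfies $|N_{i,j}|\le |M_{i,j}|$ for all $(i,j)\in I^2$, then $N$ belongs to it and the norm of $N$ is at most that of $M$. Let $\mathcal{T}$ be the vector space of all rank-four tensors $A=(A_{i,k,l,j})_{(i,k,l,j)\in I_1\times I_2^2\times I_1}$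 with complex entries, i.e. all maps $I_1\times I_2\times I_2\times I_1\to\mathbb{C}$. For $A\in\mathcal{T}$ and $(i,j)\in I_1^2$ let $A|_{\{i\}\times I_2^2\times\{j\}}$ be the matrix $(A_{i,k,l,j})_{(k,l)\in I_2^2}$, and for $(k,l)\in I_2^2$ let $A|_{I_1\times\{(k,l)\}\times I_1}$ be the matrix $(A_{i,k,l,j})_{(i,j)\in I_1^2}$. Define $$\|A\|_{\widetilde{\mathcal{A}}_1} := \Big\| \big( \| A|_{\{i\}\times I_2^2\times\{j\}} \|_{\mathcal{B}(\ell^2(I_2))} \big)_{(i,j)\in I_1^2} \Big\|_{\mathcal{A}_1},\qquad \|A\|_{\widetilde{\mathcal{A}}_2} := \Big\| \big( \| A|_{I_1\times\{(k,l)\}\times I_1} \|_{\mathcal{B}(\ell^2(I_1))} \big)_{(k,l)\in I_2^2} \Big\|_{\mathcal{A}_2},$$ where $\|\cdot\|_{\mathcal{B}(\ell^2)}$ is the operator norm, and the expressions are taken to be $+\infty$ if some restricted matrix does not define a bounded operator or if the resulting matrix of norms does not lie in $\mathcal{A}_1$ (resp. $\mathcal{A}_2$). Set $\widetilde{\mathcal{A}}_n := \{A\in\mathcal{T} : \|A\|_{\widetilde{\mathcal{A}}_n}<\infty\}$ for $n=1,2$. The doubly contracted tensor product of $A,B\in\mathcal{T}$ is $(A:B)_{i,k,l,j} := \sum_{n\in I_2}\sum_{m\in I_1} A_{i,k,n,m}\,B_{m,n,l,j}$. *)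

theory Defs
  imports "HOL-Analysis.Analysis" "HOL-Library.Function_Algebras"
begin

section \<open>Banach algebras on a carrier set\<close>

text \<open>The carrier \<open>V\<close> is a linear subspace of an ambient complex vector space \<open>'v\<close>; the norm and the
  multiplication are only constrained on \<open>V\<close>. No unit is required.\<close>

locale banach_space_on = vector_space scale
  for scale :: "complex \<Rightarrow> 'v::ab_group_add \<Rightarrow> 'v" +
  fixes V :: "'v set" and nrm :: "'v \<Rightarrow> real"
  assumes subspace_carrier: "subspace V"
    and nrm_nonneg: "x \<in> V \<Longrightarrow> 0 \<le> nrm x"
    and nrm_eq_0_iff: "x \<in> V \<Longrightarrow> nrm x = 0 \<longleftrightarrow> x = 0"
    and nrm_triangle: "x \<in> V \<Longrightarrow> y \<in> V \<Longrightarrow> nrm (x + y) \<le> nrm x + nrm y"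
    and nrm_scale: "x \<in> V \<Longrightarrow> nrm (scale c x) = cmod c * nrm x"
    and complete_carrier:
      "(\<And>n::nat. X n \<in> V) \<Longrightarrow> (\<And>e. e > 0 \<Longrightarrow> \<exists>N. \<forall>m\<ge>N. \<forall>n\<ge>N. nrm (X m - X n) < e) \<Longrightarrow>
        \<exists>L\<in>V. (\<lambda>n. nrm (X n - L)) \<longlonglongrightarrow> 0"

locale banach_algebra_on = banach_space_on scale V nrm
  for scale :: "complex \<Rightarrow> 'v::ab_group_add \<Rightarrow> 'v" and V :: "'v set" and nrm :: "'v \<Rightarrow> real" +
  fixes mul :: "'v \<Rightarrow> 'v \<Rightarrow> 'v"
  assumes mul_closed: "x \<in> V \<Longrightarrow> y \<in> V \<Longrightarrow> mul x y \<in> V"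
    and mul_assoc: "x \<in> V \<Longrightarrow> y \<in> V \<Longrightarrow> z \<in> V \<Longrightarrow> mul (mul x y) z = mul x (mul y z)"
    and mul_add_left: "x \<in> V \<Longrightarrow> y \<in> V \<Longrightarrow> z \<in> V \<Longrightarrow> mul (x + y) z = mul x z + mul y z"
    and mul_add_right: "x \<in> V \<Longrightarrow> y \<in> V \<Longrightarrow> z \<in> V \<Longrightarrow> mul x (y + z) = mul x y + mul x z"
    and mul_scale_left: "x \<in> V \<Longrightarrow> y \<in> V \<Longrightarrow> mul (scale c x) y = scale c (mul x y)"
    and mul_scale_right: "x \<in> V \<Longrightarrow> y \<in> V \<Longrightarrow> mul x (scale c y) = scale c (mul x y)"
    and nrm_mul: "x \<in> V \<Longrightarrow> y \<in> V \<Longrightarrow> nrm (mul x y) \<le> nrm x * nrm y"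

locale involutive_banach_algebra_on = banach_algebra_on scale V nrm mul
  for scale :: "complex \<Rightarrow> 'v::ab_group_add \<Rightarrow> 'v" and V :: "'v set" and nrm :: "'v \<Rightarrow> real"
    and mul :: "'v \<Rightarrow> 'v \<Rightarrow> 'v" +
  fixes star :: "'v \<Rightarrow> 'v"
  assumes star_closed: "x \<in> V \<Longrightarrow> star x \<in> V"
    and star_star: "x \<in> V \<Longrightarrow> star (star x) = x"
    and star_add: "x \<in> V \<Longrightarrow> y \<in> V \<Longrightarrow> star (x + y) = star x + star y"
    and star_scale: "x \<in> V \<Longrightarrow> star (scale c x) = scale (cnj c) (star x)"
    and star_mul: "x \<in> V \<Longrightarrow> y \<in> V \<Longrightarrow> star (mul x y) = mul (star y) (star x)"
    and nrm_star: "x \<in> V \<Longrightarrow> nrm (star x) = nrm x"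


section \<open>Matrices and solid involutive Banach algebras of matrices\<close>

text \<open>The index set is the universe of a type. Addition and zero of matrices (and of tensors below)
  are the pointwise ones of \<^theory>\<open>HOL-Library.Function_Algebras\<close>; its pointwise product is not
  used. The index set carries no order, so convergence of a series means \<^const>\<open>summable_on\<close>.\<close>

type_synonym 'i cmatrix = "'i \<Rightarrow> 'i \<Rightarrow> complex"

definition mat_scale :: "complex \<Rightarrow> 'i cmatrix \<Rightarrow> 'i cmatrix"
  where "mat_scale c M = (\<lambda>i j. c * M i j)"

definition mat_mult :: "'i cmatrix \<Rightarrow> 'i cmatrix \<Rightarrow> 'i cmatrix"
  where "mat_mult M N = (\<lambda>i j. \<Sum>\<^sub>\<infinity>k. M i k * N k j)"

definition mat_adjoint :: "'i cmatrix \<Rightarrow> 'i cmatrix"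
  where "mat_adjoint M = (\<lambda>i j. cnj (M j i))"

lemma vector_space_mat_scale: "vector_space mat_scale"
  by standard (auto simp: mat_scale_def fun_eq_iff algebra_simps)

locale banach_matrix_algebra =
  banach_space_on "mat_scale :: complex \<Rightarrow> 'i cmatrix \<Rightarrow> 'i cmatrix" \<A> nrm
  for \<A> :: "'i cmatrix set" and nrm :: "'i cmatrix \<Rightarrow> real" +
  assumes mat_mult_summable: "M \<in> \<A> \<Longrightarrow> N \<in> \<A> \<Longrightarrow> (\<lambda>k. M i k * N k j) summable_on UNIV"
    and mat_mult_closed: "M \<in> \<A> \<Longrightarrow> N \<in> \<A> \<Longrightarrow> mat_mult M N \<in> \<A>"
    and nrm_mat_mult: "M \<in> \<A> \<Longrightarrow> N \<in> \<A> \<Longrightarrow> nrm (mat_mult M N) \<le> nrm M * nrm N"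

locale involutive_banach_matrix_algebra = banach_matrix_algebra \<A> nrm
  for \<A> :: "'i cmatrix set" and nrm :: "'i cmatrix \<Rightarrow> real" +
  assumes mat_adjoint_closed: "M \<in> \<A> \<Longrightarrow> mat_adjoint M \<in> \<A>"
    and nrm_mat_adjoint: "M \<in> \<A> \<Longrightarrow> nrm (mat_adjoint M) = nrm M"

locale solid_involutive_banach_matrix_algebra = involutive_banach_matrix_algebra \<A> nrm
  for \<A> :: "'i cmatrix set" and nrm :: "'i cmatrix \<Rightarrow> real" +
  assumes solid_closed: "M \<in> \<A> \<Longrightarrow> (\<And>i j. cmod (N i j) \<le> cmod (M i j)) \<Longrightarrow> N \<in> \<A>"
    and solid_nrm: "M \<in> \<A> \<Longrightarrow> (\<And>i j. cmod (N i j) \<le> cmod (M i j)) \<Longrightarrow> nrm N \<le> nrm M"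


section \<open>Matrices as operators on the space of square-summable families\<close>

definition ell2 :: "('i \<Rightarrow> complex) set"
  where "ell2 = {x. (\<lambda>i. (cmod (x i))\<^sup>2) summable_on UNIV}"

definition ell2_norm :: "('i \<Rightarrow> complex) \<Rightarrow> real"
  where "ell2_norm x = sqrt (\<Sum>\<^sub>\<infinity>i. (cmod (x i))\<^sup>2)"

definition mat_vec :: "'i cmatrix \<Rightarrow> ('i \<Rightarrow> complex) \<Rightarrow> ('i \<Rightarrow> complex)"
  where "mat_vec M x = (\<lambda>k. \<Sum>\<^sub>\<infinity>l. M k l * x l)"

definition ell2_bounded :: "'i cmatrix \<Rightarrow> bool"
  where "ell2_bounded M \<longleftrightarrow>
    (\<forall>x\<in>ell2. (\<forall>k. (\<lambda>l. M k l * x l) summable_on UNIV) \<and> mat_vec M x \<in> ell2) \<and>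
    (\<exists>C. \<forall>x\<in>ell2. ell2_norm (mat_vec M x) \<le> C * ell2_norm x)"

text \<open>As in \<^const>\<open>onorm\<close>, the zero vector contributes \<open>0 / 0 = 0\<close>. The value is meaningful only
  when \<^term>\<open>ell2_bounded M\<close> holds.\<close>

definition ell2_opnorm :: "'i cmatrix \<Rightarrow> real"
  where "ell2_opnorm M = (SUP x\<in>ell2. ell2_norm (mat_vec M x) / ell2_norm x)"


section \<open>Rank-four tensors\<close>

type_synonym ('i, 'k) tensor4 = "'i \<Rightarrow> 'k \<Rightarrow> 'k \<Rightarrow> 'i \<Rightarrow> complex"

definition tensor_scale :: "complex \<Rightarrow> ('i, 'k) tensor4 \<Rightarrow> ('i, 'k) tensor4"
  where "tensor_scale c A = (\<lambda>i k l j. c * A i k l j)"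

lemma vector_space_tensor_scale: "vector_space tensor_scale"
  by standard (auto simp: tensor_scale_def fun_eq_iff algebra_simps)

definition tensor_adjoint :: "('i, 'k) tensor4 \<Rightarrow> ('i, 'k) tensor4"
  where "tensor_adjoint A = (\<lambda>i k l j. cnj (A j l k i))"

definition double_contraction ::
    "('i, 'k) tensor4 \<Rightarrow> ('i, 'k) tensor4 \<Rightarrow> ('i, 'k) tensor4"
  where "double_contraction A B = (\<lambda>i k l j. \<Sum>\<^sub>\<infinity>n. \<Sum>\<^sub>\<infinity>m. A i k n m * B m n l j)"

text \<open>\<^const>\<open>infsum\<close> is \<open>0\<close> for divergent series, hence well-definedness of the double
  contraction has to be expressed separately.\<close>

definition double_contraction_converges :: "('i, 'k) tensor4 \<Rightarrow> ('i, 'k) tensor4 \<Rightarrow> bool"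
  where "double_contraction_converges A B \<longleftrightarrow>
    (\<forall>i k l j. (\<forall>n. (\<lambda>m. A i k n m * B m n l j) summable_on UNIV) \<and>
      (\<lambda>n. \<Sum>\<^sub>\<infinity>m. A i k n m * B m n l j) summable_on UNIV)"

text \<open>The argument \<open>B\<close> is a matrix of matrices: each block is replaced by its operator norm, and the
  norm of the resulting matrix is taken in \<open>\<A>\<close>.\<close>

definition block_norm ::
    "'i cmatrix set \<Rightarrow> ('i cmatrix \<Rightarrow> real) \<Rightarrow> ('i \<Rightarrow> 'i \<Rightarrow> 'k cmatrix) \<Rightarrow> ereal"
  where "block_norm \<A> nrm B =
    (if (\<forall>i j. ell2_bounded (B i j)) \<and> (\<lambda>i j. complex_of_real (ell2_opnorm (B i j))) \<in> \<A>
     then ereal (nrm (\<lambda>i j. complex_of_real (ell2_opnorm (B i j)))) else \<infinity>)"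

definition tensor_norm1 ::
    "'i cmatrix set \<Rightarrow> ('i cmatrix \<Rightarrow> real) \<Rightarrow> ('i, 'k) tensor4 \<Rightarrow> ereal"
  where "tensor_norm1 \<A>\<^sub>1 nrm\<^sub>1 A = block_norm \<A>\<^sub>1 nrm\<^sub>1 (\<lambda>i j. \<lambda>k l. A i k l j)"

definition tensor_norm2 ::
    "'k cmatrix set \<Rightarrow> ('k cmatrix \<Rightarrow> real) \<Rightarrow> ('i, 'k) tensor4 \<Rightarrow> ereal"
  where "tensor_norm2 \<A>\<^sub>2 nrm\<^sub>2 A = block_norm \<A>\<^sub>2 nrm\<^sub>2 (\<lambda>k l. \<lambda>i j. A i k l j)"

definition tensor_space1 ::
    "'i cmatrix set \<Rightarrow> ('i cmatrix \<Rightarrow> real) \<Rightarrow> ('i, 'k) tensor4 set"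
  where "tensor_space1 \<A>\<^sub>1 nrm\<^sub>1 = {A. tensor_norm1 \<A>\<^sub>1 nrm\<^sub>1 A < \<infinity>}"

definition tensor_space2 ::
    "'k cmatrix set \<Rightarrow> ('k cmatrix \<Rightarrow> real) \<Rightarrow> ('i, 'k) tensor4 set"
  where "tensor_space2 \<A>\<^sub>2 nrm\<^sub>2 = {A. tensor_norm2 \<A>\<^sub>2 nrm\<^sub>2 A < \<infinity>}"

definition tensor_norm ::
    "'i cmatrix set \<Rightarrow> ('i cmatrix \<Rightarrow> real) \<Rightarrow> 'k cmatrix set \<Rightarrow> ('k cmatrix \<Rightarrow> real) \<Rightarrow>
      ('i, 'k) tensor4 \<Rightarrow> real"
  where "tensor_norm \<A>\<^sub>1 nrm\<^sub>1 \<A>\<^sub>2 nrm\<^sub>2 A =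
    real_of_ereal (max (tensor_norm1 \<A>\<^sub>1 nrm\<^sub>1 A) (tensor_norm2 \<A>\<^sub>2 nrm\<^sub>2 A))"

end

theory Submission
  imports Defs
begin

text \<open>A matrix \<open>M\<close> is bounded on \<open>\<ell>\<^sup>2\<close> with operator norm at most \<open>C\<close> iff its bilinear form satisfies
  \<open>\<bar>\<Sum> x\<^sub>i M\<^sub>i\<^sub>j y\<^sub>j\<bar> \<le> C \<parallel>x\<parallel> \<parallel>y\<parallel>\<close> for all finite sums. This criterion is visibly stable under transposition,
  absolutely convergent series and entrywise limits.

  A tensor is regarded as a matrix of bounded matrices in two ways, by \<open>(i, j)\<close>-blocks and by
  \<open>(k, l)\<close>-blocks; in both pictures the double contraction is block multiplication. The matrix of
  block norms of a product is dominated entrywise by the product of the matrices of block norms, so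
  solidity gives submultiplicativity, and the same domination gives the absolute convergence needed
  to exchange the two contractions and to prove associativity. For completeness, solidity makes the
  entries continuous functionals, so a Cauchy sequence converges entrywise in both pictures, hence to
  the same tensor.\<close>

no_notation Infinite_Set_Sum.abs_summable_on (infix "abs'_summable'_on" 50)

section \<open>Unconditional sums of complex numbers\<close>

lemma infsum_finite_sum:
  fixes f :: "'a \<Rightarrow> 'b \<Rightarrow> complex"
  assumes "finite F" and "\<And>i. i \<in> F \<Longrightarrow> f i summable_on A"
  shows "(\<lambda>a. \<Sum>i\<in>F. f i a) summable_on A"
    and "infsum (\<lambda>a. \<Sum>i\<in>F. f i a) A = (\<Sum>i\<in>F. infsum (f i) A)"
proof -
  have "(\<lambda>a. \<Sum>i\<in>F. f i a) summable_on A \<and> infsum (\<lambda>a. \<Sum>i\<in>F. f i a) A = (\<Sum>i\<in>F. infsum (f i) A)"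
    using assms by (induction F rule: finite_induct) (simp_all add: summable_on_add infsum_add)
  then show "(\<lambda>a. \<Sum>i\<in>F. f i a) summable_on A"
    and "infsum (\<lambda>a. \<Sum>i\<in>F. f i a) A = (\<Sum>i\<in>F. infsum (f i) A)" by blast+
qed

lemma abs_summable_finite_bound:
  fixes f :: "'a \<Rightarrow> complex"
  assumes "\<And>F. finite F \<Longrightarrow> (\<Sum>i\<in>F. cmod (f i)) \<le> C"
  shows "f abs_summable_on A" and "cmod (infsum f A) \<le> C" and "(\<Sum>\<^sub>\<infinity>i\<in>A. cmod (f i)) \<le> C"
proof -
  show s: "f abs_summable_on A"
    by (rule nonneg_bdd_above_summable_on) (auto intro!: bdd_aboveI2[where M=C] assms)
  show le: "(\<Sum>\<^sub>\<infinity>i\<in>A. cmod (f i)) \<le> C"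
    using s assms by (rule infsum_le_finite_sums)
  show "cmod (infsum f A) \<le> C"
    using norm_infsum_bound[OF s] le by linarith
qed

section \<open>Square-summable families\<close>

lemma L2_set_le_ell2_norm:
  assumes "x \<in> ell2" "finite F"
  shows "L2_set (\<lambda>i. cmod (x i)) F \<le> ell2_norm x"
  using assms unfolding ell2_def ell2_norm_def L2_set_def
  by (auto intro!: finite_sum_le_infsum)

text \<open>The squared finite partial sums are increasing and bounded by the square of
  \<open>C\<close>. Membership in \<open>ell2\<close> is thereby reduced to finite sections, where
  \<open>L2_set\<close> is available.\<close>

lemma ell2I:
  assumes "\<And>F. finite F \<Longrightarrow> L2_set (\<lambda>i. cmod (x i)) F \<le> C"
  shows "x \<in> ell2" and "ell2_norm x \<le> C"
proof -
  have C: "0 \<le> C" using assms[of "{}"] by simp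
  have bd: "(\<Sum>i\<in>F. (cmod (x i))\<^sup>2) \<le> C\<^sup>2" if "finite F" for F
    using assms[OF that] C unfolding L2_set_def by (simp add: sqrt_le_D)
  have s: "(\<lambda>i. (cmod (x i))\<^sup>2) summable_on UNIV"
    by (rule nonneg_bdd_above_summable_on) (auto intro!: bdd_aboveI2[where M="C\<^sup>2"] bd)
  then show "x \<in> ell2" by (simp add: ell2_def)
  have "(\<Sum>\<^sub>\<infinity>i. (cmod (x i))\<^sup>2) \<le> C\<^sup>2"
    using s bd by (rule infsum_le_finite_sums)
  then show "ell2_norm x \<le> C" unfolding ell2_norm_def using C by (simp add: real_le_lsqrt)
qed

lemma ell2_norm_nonneg: "0 \<le> ell2_norm x"
  unfolding ell2_norm_def by (simp add: infsum_nonneg)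

lemma zero_in_ell2: "(\<lambda>_. 0) \<in> ell2"
  by (simp add: ell2_def)

lemma finite_support_ell2:
  assumes "finite G"
  shows "(\<lambda>i. if i \<in> G then x i else 0) \<in> ell2"
    and "ell2_norm (\<lambda>i. if i \<in> G then x i else 0) = L2_set (\<lambda>i. cmod (x i)) G"
proof -
  have *: "((\<lambda>i. (cmod (if i \<in> G then x i else 0))\<^sup>2) has_sum (\<Sum>i\<in>G. (cmod (x i))\<^sup>2)) UNIV"
    by (rule has_sum_cong_neutral[THEN iffD1, OF _ _ _ has_sum_finite[OF assms]]) auto
  show "(\<lambda>i. if i \<in> G then x i else 0) \<in> ell2"
    using * unfolding ell2_def summable_on_def by blast
  show "ell2_norm (\<lambda>i. if i \<in> G then x i else 0) = L2_set (\<lambda>i. cmod (x i)) G"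
    unfolding ell2_norm_def L2_set_def using infsumI[OF *] by simp
qed

lemma ell2_Cauchy_Schwarz:
  assumes "x \<in> ell2" "y \<in> ell2"
  shows "(\<lambda>i. x i * y i) abs_summable_on UNIV"
    and "cmod (\<Sum>\<^sub>\<infinity>i. x i * y i) \<le> ell2_norm x * ell2_norm y"
    and "(\<Sum>\<^sub>\<infinity>i. cmod (x i * y i)) \<le> ell2_norm x * ell2_norm y"
proof -
  have *: "(\<Sum>i\<in>F. cmod (x i * y i)) \<le> ell2_norm x * ell2_norm y" if "finite F" for F
  proof -
    have "(\<Sum>i\<in>F. cmod (x i * y i)) \<le> L2_set (\<lambda>i. cmod (x i)) F * L2_set (\<lambda>i. cmod (y i)) F"
      using L2_set_mult_ineq[of "\<lambda>i. cmod (x i)" "\<lambda>i. cmod (y i)" F] by (simp add: norm_mult)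
    also have "\<dots> \<le> ell2_norm x * ell2_norm y"
      using assms that by (intro mult_mono L2_set_le_ell2_norm) (auto simp: ell2_norm_nonneg)
    finally show ?thesis .
  qed
  show "(\<lambda>i. x i * y i) abs_summable_on UNIV"
    and "cmod (\<Sum>\<^sub>\<infinity>i. x i * y i) \<le> ell2_norm x * ell2_norm y"
    and "(\<Sum>\<^sub>\<infinity>i. cmod (x i * y i)) \<le> ell2_norm x * ell2_norm y"
    using abs_summable_finite_bound[OF *] by auto
qed

lemmas ell2_product_summable = abs_summable_summable[OF ell2_Cauchy_Schwarz(1)]

text \<open>The squared norm of the tail is the full sum minus a partial sum. This makes the
  remainder vanish in \<open>bilinear_form_assoc\<close>.\<close>

lemma ell2_tail_tendsto_0:
  assumes "x \<in> ell2"
  shows "((\<lambda>F. ell2_norm (\<lambda>i. if i \<in> F then 0 else x i)) \<longlongrightarrow> 0) (finite_subsets_at_top UNIV)"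
proof -
  let ?f = "\<lambda>i. (cmod (x i))\<^sup>2"
  have s: "?f summable_on UNIV" using assms by (simp add: ell2_def)
  have "((\<lambda>F. sqrt (infsum ?f UNIV - sum ?f F)) \<longlongrightarrow> sqrt (infsum ?f UNIV - infsum ?f UNIV))
      (finite_subsets_at_top UNIV)"
    using s by (intro tendsto_intros infsum_tendsto)
  moreover have "sqrt (infsum ?f UNIV - sum ?f F) = ell2_norm (\<lambda>i. if i \<in> F then 0 else x i)"
    if "finite F" for F
  proof -
    have "(\<Sum>\<^sub>\<infinity>i. (cmod (if i \<in> F then 0 else x i))\<^sup>2) = infsum ?f (UNIV - F)"
      by (rule infsum_cong_neutral) auto
    also have "\<dots> = infsum ?f UNIV - sum ?f F"
      using infsum_Diff[OF s, of F] that by simp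
    finally show ?thesis by (simp add: ell2_norm_def)
  qed
  then have "\<forall>\<^sub>F F in finite_subsets_at_top UNIV.
      sqrt (infsum ?f UNIV - sum ?f F) = ell2_norm (\<lambda>i. if i \<in> F then 0 else x i)"
    by (rule eventually_finite_subsets_at_top_weakI)
  ultimately show ?thesis
    using Lim_transform_eventually by fastforce
qed

lemma ell2_tail:
  assumes "x \<in> ell2"
  shows "(\<lambda>i. if i \<in> F then 0 else x i) \<in> ell2"
  using assms unfolding ell2_def
  by (auto intro: summable_on_comparison_test[where f="\<lambda>i. (cmod (x i))\<^sup>2"])

text \<open>Testing with the conjugate of \<open>v\<close> gives that the square of its norm is at
  most \<open>C\<close> times its norm; the norm is then cancelled unless it is zero, where
  \<open>0 \<le> C\<close> suffices.\<close>

lemma L2_set_le_by_duality: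
  assumes "finite F" "0 \<le> C"
    and "\<And>x. cmod (\<Sum>i\<in>F. x i * v i) \<le> C * L2_set (\<lambda>i. cmod (x i)) F"
  shows "L2_set (\<lambda>i. cmod (v i)) F \<le> C"
proof -
  let ?L = "L2_set (\<lambda>i. cmod (v i)) F"
  have "(\<Sum>i\<in>F. cnj (v i) * v i) = of_real (\<Sum>i\<in>F. (cmod (v i))\<^sup>2)"
    by (simp only: of_real_sum complex_norm_square mult.commute)
  then have "cmod (\<Sum>i\<in>F. cnj (v i) * v i) = ?L * ?L"
    unfolding L2_set_def
    by (simp only: norm_of_real) (simp add: sum_nonneg)
  with assms(3)[of "\<lambda>i. cnj (v i)"] have "?L * ?L \<le> C * ?L" by simp
  then show ?thesis
    using L2_set_nonneg[of "\<lambda>i. cmod (v i)" F] assms(2)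
    by (cases "?L = 0") (auto simp: mult_le_cancel_right)
qed


section \<open>Bounded bilinear forms\<close>

definition bilinear_bound :: "'i cmatrix \<Rightarrow> real \<Rightarrow> bool"
  where "bilinear_bound M C \<longleftrightarrow> (\<forall>F G x y. finite F \<longrightarrow> finite G \<longrightarrow>
    cmod (\<Sum>i\<in>F. \<Sum>j\<in>G. x i * M i j * y j) \<le>
      C * (L2_set (\<lambda>i. cmod (x i)) F * L2_set (\<lambda>j. cmod (y j)) G))"

lemma bilinear_boundD:
  assumes "bilinear_bound M C" "finite F" "finite G"
  shows "cmod (\<Sum>i\<in>F. \<Sum>j\<in>G. x i * M i j * y j) \<le>
      C * (L2_set (\<lambda>i. cmod (x i)) F * L2_set (\<lambda>j. cmod (y j)) G)"
  using assms unfolding bilinear_bound_def by blast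

lemma bilinear_bound_entry:
  assumes "bilinear_bound M C"
  shows "cmod (M i j) \<le> C"
  using bilinear_boundD[OF assms, of "{i}" "{j}" "\<lambda>_. 1" "\<lambda>_. 1"] by simp

lemma bilinear_bound_nonneg:
  assumes "bilinear_bound M C"
  shows "0 \<le> C"
  using bilinear_bound_entry[OF assms, of undefined undefined] norm_ge_zero order_trans by blast

lemma bilinear_bound_transpose:
  assumes "bilinear_bound M C"
  shows "bilinear_bound (\<lambda>i j. M j i) C"
  unfolding bilinear_bound_def
proof (intro allI impI)
  fix F G :: "'a set" and x y :: "'a \<Rightarrow> complex" assume "finite F" "finite G"
  from bilinear_boundD[OF assms this(2,1), of y x]
  show "cmod (\<Sum>i\<in>F. \<Sum>j\<in>G. x i * M j i * y j) \<le>
      C * (L2_set (\<lambda>i. cmod (x i)) F * L2_set (\<lambda>j. cmod (y j)) G)"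
    by (subst sum.swap) (simp add: mult_ac)
qed

lemma bilinear_bound_adjoint:
  assumes "bilinear_bound M C"
  shows "bilinear_bound (mat_adjoint M) C"
  unfolding bilinear_bound_def
proof (intro allI impI)
  fix F G :: "'a set" and x y :: "'a \<Rightarrow> complex" assume "finite F" "finite G"
  from bilinear_boundD[OF bilinear_bound_transpose[OF assms] this, of "\<lambda>i. cnj (x i)" "\<lambda>i. cnj (y i)"]
  have "cmod (cnj (\<Sum>i\<in>F. \<Sum>j\<in>G. x i * mat_adjoint M i j * y j)) \<le>
      C * (L2_set (\<lambda>i. cmod (x i)) F * L2_set (\<lambda>j. cmod (y j)) G)"
    by (simp add: mat_adjoint_def)
  then show "cmod (\<Sum>i\<in>F. \<Sum>j\<in>G. x i * mat_adjoint M i j * y j) \<le>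
      C * (L2_set (\<lambda>i. cmod (x i)) F * L2_set (\<lambda>j. cmod (y j)) G)"
    by (simp only: complex_mod_cnj)
qed

lemma bilinear_bound_0: "bilinear_bound (\<lambda>i j. 0) 0"
  by (simp add: bilinear_bound_def)

lemma bilinear_bound_add:
  assumes "bilinear_bound M C" "bilinear_bound N D"
  shows "bilinear_bound (\<lambda>i j. M i j + N i j) (C + D)"
  unfolding bilinear_bound_def
proof (intro allI impI)
  fix F G :: "'a set" and x y :: "'a \<Rightarrow> complex" assume FG: "finite F" "finite G"
  have "cmod (\<Sum>i\<in>F. \<Sum>j\<in>G. x i * (M i j + N i j) * y j) =
      cmod ((\<Sum>i\<in>F. \<Sum>j\<in>G. x i * M i j * y j) + (\<Sum>i\<in>F. \<Sum>j\<in>G. x i * N i j * y j))"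
    by (simp add: sum.distrib[symmetric] algebra_simps)
  also have "\<dots> \<le> (C + D) * (L2_set (\<lambda>i. cmod (x i)) F * L2_set (\<lambda>j. cmod (y j)) G)"
    by (rule order_trans[OF norm_triangle_ineq])
      (use bilinear_boundD[OF assms(1) FG, of x y] bilinear_boundD[OF assms(2) FG, of x y]
        in \<open>simp add: distrib_right\<close>)
  finally show "cmod (\<Sum>i\<in>F. \<Sum>j\<in>G. x i * (M i j + N i j) * y j) \<le>
      (C + D) * (L2_set (\<lambda>i. cmod (x i)) F * L2_set (\<lambda>j. cmod (y j)) G)" .
qed

lemma bilinear_bound_scale:
  assumes "bilinear_bound M C"
  shows "bilinear_bound (\<lambda>i j. c * M i j) (cmod c * C)"
  unfolding bilinear_bound_def
proof (intro allI impI)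
  fix F G :: "'a set" and x y :: "'a \<Rightarrow> complex" assume FG: "finite F" "finite G"
  have "(\<Sum>i\<in>F. \<Sum>j\<in>G. x i * (c * M i j) * y j) = c * (\<Sum>i\<in>F. \<Sum>j\<in>G. x i * M i j * y j)"
    by (simp add: sum_distrib_left algebra_simps)
  then show "cmod (\<Sum>i\<in>F. \<Sum>j\<in>G. x i * (c * M i j) * y j) \<le>
      cmod c * C * (L2_set (\<lambda>i. cmod (x i)) F * L2_set (\<lambda>j. cmod (y j)) G)"
    using mult_left_mono[OF bilinear_boundD[OF assms FG, of x y], of "cmod c"]
    by (simp add: norm_mult mult.assoc)
qed

text \<open>For fixed finite sets and vectors both sides depend continuously on finitely many
  entries and on the bound. The filter is arbitrary because the lemma serves infinite sums as well
  as limits of sequences.\<close>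

lemma bilinear_bound_limit:
  fixes M :: "'n \<Rightarrow> 'i cmatrix"
  assumes "\<And>i j. ((\<lambda>n. M n i j) \<longlongrightarrow> L i j) T" and "(c \<longlongrightarrow> C) T" and "T \<noteq> bot"
    and "eventually (\<lambda>n. bilinear_bound (M n) (c n)) T"
  shows "bilinear_bound L C"
  unfolding bilinear_bound_def
proof (intro allI impI)
  fix F G :: "'i set" and x y :: "'i \<Rightarrow> complex" assume FG: "finite F" "finite G"
  show "cmod (\<Sum>i\<in>F. \<Sum>j\<in>G. x i * L i j * y j) \<le>
      C * (L2_set (\<lambda>i. cmod (x i)) F * L2_set (\<lambda>j. cmod (y j)) G)"
  proof (rule tendsto_le[OF assms(3)])
    show "((\<lambda>n. cmod (\<Sum>i\<in>F. \<Sum>j\<in>G. x i * M n i j * y j)) \<longlongrightarrow>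
        cmod (\<Sum>i\<in>F. \<Sum>j\<in>G. x i * L i j * y j)) T"
      by (intro tendsto_intros assms)
    show "((\<lambda>n. c n * (L2_set (\<lambda>i. cmod (x i)) F * L2_set (\<lambda>j. cmod (y j)) G)) \<longlongrightarrow>
        C * (L2_set (\<lambda>i. cmod (x i)) F * L2_set (\<lambda>j. cmod (y j)) G)) T"
      by (intro tendsto_intros assms)
    show "eventually (\<lambda>n. cmod (\<Sum>i\<in>F. \<Sum>j\<in>G. x i * M n i j * y j) \<le>
        c n * (L2_set (\<lambda>i. cmod (x i)) F * L2_set (\<lambda>j. cmod (y j)) G)) T"
      using assms(4) by eventually_elim (rule bilinear_boundD[OF _ FG])
  qed
qed

lemma bilinear_bound_sum:
  assumes "finite P" "\<And>p. p \<in> P \<Longrightarrow> bilinear_bound (M p) (c p)"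
  shows "bilinear_bound (\<lambda>i j. \<Sum>p\<in>P. M p i j) (\<Sum>p\<in>P. c p)"
  using assms by (induction P rule: finite_induct) (auto simp: bilinear_bound_0 bilinear_bound_add)

lemma bilinear_bound_abs_summable:
  assumes "\<And>p. bilinear_bound (M p) (c p)" "c summable_on UNIV"
  shows "(\<lambda>p. M p i j) abs_summable_on UNIV"
  by (rule Infinite_Sum.abs_summable_on_comparison_test'[OF assms(2)]) (rule bilinear_bound_entry[OF assms(1)])

lemmas bilinear_bound_summable = abs_summable_summable[OF bilinear_bound_abs_summable]

text \<open>Finite partial sums are bounded by the triangle inequality, and bounds survive the limit
  along finite sets.\<close>

lemma bilinear_bound_infsum:
  assumes "\<And>p. bilinear_bound (M p) (c p)" "c summable_on UNIV"
  shows "bilinear_bound (\<lambda>i j. \<Sum>\<^sub>\<infinity>p. M p i j) (\<Sum>\<^sub>\<infinity>p. c p)"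
proof (rule bilinear_bound_limit)
  show "((\<lambda>P. \<Sum>p\<in>P. M p i j) \<longlongrightarrow> (\<Sum>\<^sub>\<infinity>p. M p i j)) (finite_subsets_at_top UNIV)" for i j
    by (intro infsum_tendsto bilinear_bound_summable[OF assms])
  show "(sum c \<longlongrightarrow> infsum c UNIV) (finite_subsets_at_top UNIV)"
    using assms(2) by (rule infsum_tendsto)
  show "\<forall>\<^sub>F P in finite_subsets_at_top UNIV. bilinear_bound (\<lambda>i j. \<Sum>p\<in>P. M p i j) (sum c P)"
    by (rule eventually_finite_subsets_at_top_weakI) (auto intro: bilinear_bound_sum assms)
qed simp

section \<open>Bilinear bounds and operators on \<open>ell2\<close>\<close>

text \<open>With \<open>y\<close> fixed, the bilinear estimate bounds every finite section of the
  image vector by duality. This treats finitely supported arguments of the operator.\<close>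

lemma bilinear_bound_column:
  assumes M: "bilinear_bound M C" and G: "finite G"
  shows "(\<lambda>i. \<Sum>j\<in>G. M i j * y j) \<in> ell2"
    and "ell2_norm (\<lambda>i. \<Sum>j\<in>G. M i j * y j) \<le> C * L2_set (\<lambda>j. cmod (y j)) G"
proof -
  have "L2_set (\<lambda>i. cmod (\<Sum>j\<in>G. M i j * y j)) F \<le> C * L2_set (\<lambda>j. cmod (y j)) G" if "finite F" for F
    by (rule L2_set_le_by_duality)
      (use that bilinear_boundD[OF M that G, of _ y] bilinear_bound_nonneg[OF M]
        in \<open>auto simp: sum_distrib_left mult_ac\<close>)
  then show "(\<lambda>i. \<Sum>j\<in>G. M i j * y j) \<in> ell2"
    and "ell2_norm (\<lambda>i. \<Sum>j\<in>G. M i j * y j) \<le> C * L2_set (\<lambda>j. cmod (y j)) G"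
    by (fact ell2I)+
qed

lemma bilinear_bound_column_ell2:
  assumes "bilinear_bound M C"
  shows "(\<lambda>i. M i j) \<in> ell2" and "ell2_norm (\<lambda>i. M i j) \<le> C"
  using bilinear_bound_column[OF assms, of "{j}" "\<lambda>_. 1"] by auto

lemma bilinear_bound_row_ell2:
  assumes "bilinear_bound M C"
  shows "M i \<in> ell2" and "ell2_norm (M i) \<le> C"
  using bilinear_bound_column_ell2[OF bilinear_bound_transpose[OF assms], of i] by auto

text \<open>A finite section \<open>F\<close> of the output is fixed while the finite support
  \<open>G\<close> of the input grows to the whole index set; the estimate for finite support is
  uniform in both.\<close>

lemma bilinear_bound_mat_vec:
  assumes M: "bilinear_bound M C" and x: "x \<in> ell2"
  shows "mat_vec M x \<in> ell2" and "ell2_norm (mat_vec M x) \<le> C * ell2_norm x"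
proof -
  have s: "(\<lambda>l. M k l * x l) summable_on UNIV" for k
    by (rule ell2_product_summable[OF bilinear_bound_row_ell2(1)[OF M] x])
  have "L2_set (\<lambda>k. cmod (mat_vec M x k)) F \<le> C * ell2_norm x" if F: "finite F" for F
  proof (rule tendsto_upperbound)
    show "((\<lambda>G. L2_set (\<lambda>k. cmod (\<Sum>l\<in>G. M k l * x l)) F) \<longlongrightarrow> L2_set (\<lambda>k. cmod (mat_vec M x k)) F)
        (finite_subsets_at_top UNIV)"
      unfolding L2_set_def mat_vec_def by (intro tendsto_intros infsum_tendsto s)
    have "L2_set (\<lambda>k. cmod (\<Sum>l\<in>G. M k l * x l)) F \<le> C * ell2_norm x" if "finite G" for G
      using L2_set_le_ell2_norm[OF bilinear_bound_column(1)[OF M that] F, of x]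
        bilinear_bound_column(2)[OF M that, of x]
        mult_left_mono[OF L2_set_le_ell2_norm[OF x that] bilinear_bound_nonneg[OF M]]
      by linarith
    then show "\<forall>\<^sub>F G in finite_subsets_at_top UNIV.
        L2_set (\<lambda>k. cmod (\<Sum>l\<in>G. M k l * x l)) F \<le> C * ell2_norm x"
      by (auto intro: eventually_finite_subsets_at_top_weakI)
  qed simp
  then show "mat_vec M x \<in> ell2" and "ell2_norm (mat_vec M x) \<le> C * ell2_norm x"
    by (fact ell2I)+
qed

lemma bilinear_bound_imp_ell2_bounded:
  assumes "bilinear_bound M C"
  shows "ell2_bounded M"
  unfolding ell2_bounded_def
  using bilinear_bound_mat_vec[OF assms]
    ell2_product_summable[OF bilinear_bound_row_ell2(1)[OF assms]]
  by blast

text \<open>Together with \<open>ell2_bounded_imp_bilinear_bound\<close> this identifies the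
  operator norm of a bounded matrix as its least bilinear bound.\<close>

lemma ell2_opnorm_le:
  assumes "bilinear_bound M C"
  shows "ell2_opnorm M \<le> C"
  unfolding ell2_opnorm_def
proof (rule cSUP_least)
  show "ell2 \<noteq> {}" using zero_in_ell2 by blast
  fix x assume "x \<in> (ell2 :: ('a \<Rightarrow> complex) set)"
  then show "ell2_norm (mat_vec M x) / ell2_norm x \<le> C"
    using bilinear_bound_mat_vec(2)[OF assms, of x] ell2_norm_nonneg[of x] bilinear_bound_nonneg[OF assms]
    by (cases "ell2_norm x = 0") (auto simp: divide_simps)
qed

text \<open>The vector \<open>y\<close> is extended by zero to an element of \<open>ell2\<close>,
  the operator is applied to it, and the result is paired with \<open>x\<close> by Cauchy-Schwarz on
  \<open>F\<close>.\<close>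

lemma ell2_bounded_imp_bilinear_bound:
  assumes "ell2_bounded M"
  shows "bilinear_bound M (ell2_opnorm M)"
  unfolding bilinear_bound_def
proof (intro allI impI)
  fix F G :: "'a set" and x y :: "'a \<Rightarrow> complex" assume FG: "finite F" "finite G"
  define z where "z = (\<lambda>i. if i \<in> G then y i else 0)"
  note z = finite_support_ell2[OF FG(2), of y, folded z_def]
  obtain C where C: "ell2_norm (mat_vec M x) \<le> C * ell2_norm x" if "x \<in> ell2" for x
    using assms unfolding ell2_bounded_def by blast
  \<comment> \<open>A real supremum dominates its members only once the set is known to be bounded
    above. The maximum with 0 covers vectors of norm zero, whose quotient is 0.\<close>
  have "bdd_above ((\<lambda>x. ell2_norm (mat_vec M x) / ell2_norm x) ` ell2)"
  proof (rule bdd_aboveI2[where M="max C 0"])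
    fix x assume "x \<in> (ell2 :: ('a \<Rightarrow> complex) set)"
    then have "ell2_norm (mat_vec M x) \<le> max C 0 * ell2_norm x"
      using C[of x] mult_right_mono[OF max.cobounded1[of C 0] ell2_norm_nonneg[of x]] by linarith
    then show "ell2_norm (mat_vec M x) / ell2_norm x \<le> max C 0"
      using ell2_norm_nonneg[of x] by (cases "ell2_norm x = 0") (simp_all add: divide_le_eq)
  qed
  then have sup: "ell2_norm (mat_vec M z) / ell2_norm z \<le> ell2_opnorm M"
    unfolding ell2_opnorm_def using z(1) by (rule cSUP_upper2) simp
  have Mz: "mat_vec M z i = (\<Sum>j\<in>G. M i j * y j)" for i
    unfolding mat_vec_def z_def infsum_finite[OF FG(2), symmetric] by (rule infsum_cong_neutral) auto
  \<comment> \<open>If \<open>z\<close> has norm zero the quotient carries no information, and the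
    bound with \<open>C\<close> shows that the image has norm zero too.\<close>
  have le: "ell2_norm (mat_vec M z) \<le> ell2_opnorm M * ell2_norm z"
    using sup C[OF z(1)] ell2_norm_nonneg[of z]
    by (cases "ell2_norm z = 0") (auto simp: divide_simps)
  have "cmod (\<Sum>i\<in>F. \<Sum>j\<in>G. x i * M i j * y j) = cmod (\<Sum>i\<in>F. x i * mat_vec M z i)"
    by (simp add: Mz sum_distrib_left mult.assoc)
  also have "\<dots> \<le> (\<Sum>i\<in>F. \<bar>cmod (x i)\<bar> * \<bar>cmod (mat_vec M z i)\<bar>)"
    by (rule order_trans[OF norm_sum]) (simp add: norm_mult)
  also have "\<dots> \<le> L2_set (\<lambda>i. cmod (x i)) F * L2_set (\<lambda>i. cmod (mat_vec M z i)) F"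
    by (rule L2_set_mult_ineq)
  also have "\<dots> \<le> L2_set (\<lambda>i. cmod (x i)) F * (ell2_opnorm M * L2_set (\<lambda>j. cmod (y j)) G)"
  proof (rule mult_left_mono)
    have "mat_vec M z \<in> ell2" using assms z(1) unfolding ell2_bounded_def by blast
    from L2_set_le_ell2_norm[OF this FG(1)] le
    show "L2_set (\<lambda>i. cmod (mat_vec M z i)) F \<le> ell2_opnorm M * L2_set (\<lambda>j. cmod (y j)) G"
      unfolding z(2) by linarith
  qed simp
  finally show "cmod (\<Sum>i\<in>F. \<Sum>j\<in>G. x i * M i j * y j) \<le>
      ell2_opnorm M * (L2_set (\<lambda>i. cmod (x i)) F * L2_set (\<lambda>j. cmod (y j)) G)"
    by (simp add: mult_ac)
qed

section \<open>Products of bounded matrices and interchange of sums\<close>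

text \<open>Rows of \<open>M\<close> and columns of \<open>N\<close> lie in \<open>ell2\<close> with
  norms at most \<open>C\<close> and \<open>D\<close>, so Cauchy-Schwarz applies.\<close>

lemma mat_mult_abs_summable:
  assumes "bilinear_bound M C" "bilinear_bound N D"
  shows "(\<lambda>q. M i q * N q j) abs_summable_on UNIV"
    and "(\<Sum>\<^sub>\<infinity>q. cmod (M i q * N q j)) \<le> C * D"
proof -
  note r = bilinear_bound_row_ell2[OF assms(1), of i] and c = bilinear_bound_column_ell2[OF assms(2), of j]
  show "(\<lambda>q. M i q * N q j) abs_summable_on UNIV"
    by (rule ell2_Cauchy_Schwarz(1)[OF r(1) c(1)])
  show "(\<Sum>\<^sub>\<infinity>q. cmod (M i q * N q j)) \<le> C * D"
    using ell2_Cauchy_Schwarz(3)[OF r(1) c(1)]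
      mult_mono[OF r(2) c(2) bilinear_bound_nonneg[OF assms(1)] ell2_norm_nonneg]
    by linarith
qed

lemmas mat_mult_summable_bounded = abs_summable_summable[OF mat_mult_abs_summable(1)]

text \<open>The form of the product pairs the transpose of \<open>M\<close> applied to
  \<open>x\<close> with \<open>N\<close> applied to \<open>y\<close>; Cauchy-Schwarz then multiplies
  the two bounds.\<close>

lemma bilinear_bound_mat_mult:
  assumes M: "bilinear_bound M C" and N: "bilinear_bound N D"
  shows "bilinear_bound (mat_mult M N) (C * D)"
  unfolding bilinear_bound_def
proof (intro allI impI)
  fix F G :: "'a set" and x y :: "'a \<Rightarrow> complex" assume FG: "finite F" "finite G"
  let ?X = "L2_set (\<lambda>i. cmod (x i)) F" and ?Y = "L2_set (\<lambda>i. cmod (y i)) G"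
  have s: "(\<lambda>q. x i * (M i q * N q j) * y j) summable_on UNIV" for i j
    by (intro summable_on_cmult_left summable_on_cmult_right
        mat_mult_summable_bounded[OF M N])
  have "(\<Sum>i\<in>F. \<Sum>j\<in>G. x i * mat_mult M N i j * y j) =
      (\<Sum>i\<in>F. \<Sum>j\<in>G. \<Sum>\<^sub>\<infinity>q. x i * (M i q * N q j) * y j)"
    by (simp add: mat_mult_def infsum_cmult_left' infsum_cmult_right')
  also have "\<dots> = (\<Sum>i\<in>F. \<Sum>\<^sub>\<infinity>q. \<Sum>j\<in>G. x i * (M i q * N q j) * y j)"
    by (simp add: infsum_finite_sum(2)[OF FG(2)] s)
  also have "\<dots> = (\<Sum>\<^sub>\<infinity>q. \<Sum>i\<in>F. \<Sum>j\<in>G. x i * (M i q * N q j) * y j)"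
    by (subst infsum_finite_sum(2)[OF FG(1)]) (auto intro: infsum_finite_sum(1)[OF FG(2)] s)
  also have "\<dots> = (\<Sum>\<^sub>\<infinity>q. (\<Sum>i\<in>F. M i q * x i) * (\<Sum>j\<in>G. N q j * y j))"
    by (simp add: sum_product mult_ac)
  finally have eq: "(\<Sum>i\<in>F. \<Sum>j\<in>G. x i * mat_mult M N i j * y j) = \<dots>" .
  note u = bilinear_bound_column[OF bilinear_bound_transpose[OF M] FG(1), of x]
  note v = bilinear_bound_column[OF N FG(2), of y]
  have "cmod (\<Sum>i\<in>F. \<Sum>j\<in>G. x i * mat_mult M N i j * y j) \<le> (C * ?X) * (D * ?Y)"
    unfolding eq using bilinear_bound_nonneg[OF M]
    by (intro order_trans[OF ell2_Cauchy_Schwarz(2)[OF u(1) v(1)]] mult_mono u(2) v(2))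
      (auto simp: ell2_norm_nonneg)
  then show "cmod (\<Sum>i\<in>F. \<Sum>j\<in>G. x i * mat_mult M N i j * y j) \<le> C * D * (?X * ?Y)"
    by (simp add: mult_ac)
qed

lemma bilinear_form_assoc:
  assumes M: "bilinear_bound M C" and x: "x \<in> ell2" and y: "y \<in> ell2"
  shows "(\<Sum>\<^sub>\<infinity>m. (\<Sum>\<^sub>\<infinity>q. x q * M q m) * y m) = (\<Sum>\<^sub>\<infinity>q. x q * (\<Sum>\<^sub>\<infinity>m. M q m * y m))"
proof -
  let ?T = "finite_subsets_at_top UNIV" and ?M = "\<lambda>i j. M j i"
  let ?S = "\<lambda>x. \<Sum>\<^sub>\<infinity>m. mat_vec ?M x m * y m"
  note M' = bilinear_bound_transpose[OF M]
  have sx: "(\<lambda>q. M q m * z q) summable_on UNIV" if "z \<in> ell2" for m z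
    by (intro ell2_product_summable bilinear_bound_column_ell2[OF M] that)
  have sy: "(\<lambda>m. M q m * y m) summable_on UNIV" for q
    by (intro ell2_product_summable bilinear_bound_row_ell2[OF M] y)
  have fin: "(\<Sum>q\<in>F. x q * mat_vec M y q) = ?S x - ?S (\<lambda>q. if q \<in> F then 0 else x q)"
    if F: "finite F" for F
  proof -
    note t = ell2_tail[OF x, of F]
    have "(\<Sum>q\<in>F. x q * mat_vec M y q) = (\<Sum>q\<in>F. \<Sum>\<^sub>\<infinity>m. x q * (M q m * y m))"
      by (simp add: mat_vec_def infsum_cmult_right')
    also have "\<dots> = (\<Sum>\<^sub>\<infinity>m. \<Sum>q\<in>F. x q * (M q m * y m))"
      by (rule infsum_finite_sum(2)[symmetric]) (auto intro: F summable_on_cmult_right sy)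
    also have "\<dots> = (\<Sum>\<^sub>\<infinity>m. mat_vec ?M x m * y m + - (mat_vec ?M (\<lambda>q. if q \<in> F then 0 else x q) m * y m))"
    proof (rule infsum_cong)
      fix m
      have "(\<Sum>\<^sub>\<infinity>q. M q m * (if q \<in> F then 0 else x q)) = infsum (\<lambda>q. M q m * x q) (UNIV - F)"
        by (rule infsum_cong_neutral) auto
      also have "\<dots> = (\<Sum>\<^sub>\<infinity>q. M q m * x q) - (\<Sum>q\<in>F. M q m * x q)"
        using infsum_Diff[OF sx[OF x, of m], of F] F by simp
      finally have "(\<Sum>q\<in>F. M q m * x q) * y m = (
          mat_vec ?M x m - mat_vec ?M (\<lambda>q. if q \<in> F then 0 else x q) m) * y m"
        unfolding mat_vec_def by simp
      then show "(\<Sum>q\<in>F. x q * (M q m * y m)) =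
          mat_vec ?M x m * y m + - (mat_vec ?M (\<lambda>q. if q \<in> F then 0 else x q) m * y m)"
        by (simp add: right_diff_distrib left_diff_distrib sum_distrib_right sum_distrib_left mult_ac)
    qed
    also have "\<dots> = ?S x + - ?S (\<lambda>q. if q \<in> F then 0 else x q)"
      unfolding infsum_uminus[symmetric]
      by (intro infsum_add ell2_product_summable bilinear_bound_mat_vec(1)[OF M'] x y
          summable_on_uminus[THEN iffD2] t)
    finally show ?thesis by simp
  qed
  \<comment> \<open>The error in \<open>fin\<close> vanishes. The partial sums over \<open>F\<close>
    therefore tend to \<open>?S x\<close> as well as to the other iterated sum, and limits are
    unique.\<close>
  have "((\<lambda>F. ?S (\<lambda>q. if q \<in> F then 0 else x q)) \<longlongrightarrow> 0) ?T"
  proof (rule Lim_null_comparison)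
    show "((\<lambda>F. C * ell2_norm (\<lambda>q. if q \<in> F then 0 else x q) * ell2_norm y) \<longlongrightarrow> 0) ?T"
      using tendsto_mult[OF tendsto_mult[OF tendsto_const ell2_tail_tendsto_0[OF x]] tendsto_const]
      by simp
    show "\<forall>\<^sub>F F in ?T. norm (?S (\<lambda>q. if q \<in> F then 0 else x q)) \<le>
        C * ell2_norm (\<lambda>q. if q \<in> F then 0 else x q) * ell2_norm y"
      by (intro always_eventually allI order_trans[OF ell2_Cauchy_Schwarz(2)]
          bilinear_bound_mat_vec[OF M'] ell2_tail x y mult_right_mono ell2_norm_nonneg)
  qed
  from tendsto_diff[OF tendsto_const this, of "?S x", unfolded diff_zero]
  have "((\<lambda>F. \<Sum>q\<in>F. x q * mat_vec M y q) \<longlongrightarrow> ?S x) ?T"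
    by (rule Lim_transform_eventually) (auto intro!: eventually_finite_subsets_at_top_weakI simp: fin)
  moreover have "((\<lambda>F. \<Sum>q\<in>F. x q * mat_vec M y q) \<longlongrightarrow> (\<Sum>\<^sub>\<infinity>q. x q * mat_vec M y q)) ?T"
    by (intro infsum_tendsto ell2_product_summable x bilinear_bound_mat_vec(1)[OF M y])
  ultimately have "?S x = (\<Sum>\<^sub>\<infinity>q. x q * mat_vec M y q)"
    by (intro tendsto_unique[of ?T]) auto
  then show ?thesis by (simp add: mat_vec_def mult.commute)
qed

text \<open>Each entry is the bilinear form of \<open>M\<close> evaluated at a row of
  \<open>L\<close> and a column of \<open>N\<close>.\<close>

lemma mat_mult_assoc_bounded:
  assumes "bilinear_bound L C" "bilinear_bound M D" "bilinear_bound N E"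
  shows "mat_mult (mat_mult L M) N = mat_mult L (mat_mult M N)"
  unfolding mat_mult_def
  by (intro ext bilinear_form_assoc[OF assms(2)] bilinear_bound_row_ell2[OF assms(1)]
      bilinear_bound_column_ell2[OF assms(3)])

text \<open>Tonelli criterion with a majorant \<open>g\<close> for the inner sums of moduli; in the
  applications \<open>g\<close> is built from operator bounds. It supplies the joint summability
  behind the exchanges by \<open>infsum_swap_banach\<close>.\<close>

lemma abs_summable_on_prodI:
  fixes f :: "'a \<times> 'b \<Rightarrow> complex"
  assumes "\<And>x. (\<lambda>y. f (x, y)) abs_summable_on UNIV"
    and "\<And>x. (\<Sum>\<^sub>\<infinity>y. cmod (f (x, y))) \<le> g x" and "g summable_on UNIV"
  shows "f abs_summable_on UNIV \<times> UNIV"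
proof -
  have "(\<lambda>x. \<Sum>\<^sub>\<infinity>y. cmod (f (x, y))) abs_summable_on UNIV"
    by (rule Infinite_Sum.abs_summable_on_comparison_test'[OF assms(3)]) (simp add: assms(2) infsum_nonneg)
  with assms(1) show ?thesis unfolding Infinite_Sum.abs_summable_on_Sigma_iff by blast
qed

text \<open>For fixed \<open>p\<close> the sum of moduli over \<open>n\<close> is at most
  \<open>c p * D\<close>, which is summable in \<open>p\<close>; hence the two sums commute.\<close>

lemma mat_mult_infsum_left:
  assumes M: "\<And>p. bilinear_bound (M p) (c p)" and c: "c summable_on UNIV" and N: "bilinear_bound N D"
  shows "mat_mult (\<lambda>k n. \<Sum>\<^sub>\<infinity>p. M p k n) N k l = (\<Sum>\<^sub>\<infinity>p. mat_mult (M p) N k l)"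
proof -
  have "(\<lambda>(p, n). M p k n * N n l) abs_summable_on UNIV \<times> UNIV"
    by (rule abs_summable_on_prodI[where g="\<lambda>p. c p * D"])
      (auto intro: mat_mult_abs_summable[OF M N] summable_on_cmult_left c)
  then have "(\<lambda>(p, n). M p k n * N n l) summable_on UNIV \<times> UNIV"
    by (rule abs_summable_summable)
  from infsum_swap_banach[OF this] show ?thesis
    by (simp add: mat_mult_def infsum_cmult_left')
qed

text \<open>Transposition reverses the product and preserves the bounds, which reduces the claim to
  the left-hand version.\<close>

lemma mat_mult_infsum_right:
  assumes M: "\<And>p. bilinear_bound (M p) (c p)" and c: "c summable_on UNIV" and N: "bilinear_bound N D"
  shows "mat_mult N (\<lambda>n l. \<Sum>\<^sub>\<infinity>p. M p n l) k l = (\<Sum>\<^sub>\<infinity>p. mat_mult N (M p) k l)"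
  using mat_mult_infsum_left[OF bilinear_bound_transpose[OF M] c bilinear_bound_transpose[OF N], of l k]
  by (simp add: mat_mult_def mult.commute)


section \<open>Matrices of bounded matrices\<close>

definition norm_matrix :: "('i \<Rightarrow> 'i \<Rightarrow> 'k cmatrix) \<Rightarrow> 'i cmatrix"
  where "norm_matrix B = (\<lambda>i j. complex_of_real (ell2_opnorm (B i j)))"

definition block_mult ::
    "('i \<Rightarrow> 'i \<Rightarrow> 'k cmatrix) \<Rightarrow> ('i \<Rightarrow> 'i \<Rightarrow> 'k cmatrix) \<Rightarrow> 'i \<Rightarrow> 'i \<Rightarrow> 'k cmatrix"
  where "block_mult B C = (\<lambda>i j k l. \<Sum>\<^sub>\<infinity>m. mat_mult (B i m) (C m j) k l)"

context solid_involutive_banach_matrix_algebra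
begin

text \<open>Solidity makes each entry functional continuous: the matrix unit \<open>E\<close> at the
  position, scaled by the entry of \<open>M\<close>, is dominated by \<open>M\<close>. If all
  members vanish there, \<open>K = 0\<close> works.\<close>

lemma entry_bound: "\<exists>K. \<forall>M\<in>\<A>. cmod (M i j) \<le> K * nrm M"
proof (cases "\<exists>M\<in>\<A>. M i j \<noteq> 0")
  case False
  then show ?thesis by (intro exI[of _ 0]) auto
next
  case True
  then obtain M0 where M0: "M0 \<in> \<A>" "M0 i j \<noteq> 0" by blast
  define E where "E = (\<lambda>i' j'. if i' = i \<and> j' = j then 1 else 0 :: complex)"
  have E: "mat_scale c E \<in> \<A> \<and> nrm (mat_scale c E) \<le> nrm M" if "M \<in> \<A>" "c = M i j" for M c
    using solid_closed[OF that(1), of "mat_scale c E"] solid_nrm[OF that(1), of "mat_scale c E"] that(2)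
    by (simp add: mat_scale_def E_def)
  \<comment> \<open>The matrix unit itself is obtained by rescaling the one dominated by
    \<open>M0\<close>, a member that does not vanish at this position.\<close>
  have "mat_scale (inverse (M0 i j)) (mat_scale (M0 i j) E) \<in> \<A>"
    using E[OF M0(1)] by (blast intro: subspace_scale[OF subspace_carrier])
  then have EA: "E \<in> \<A>" using M0(2) by (simp add: mat_scale_def mult.assoc[symmetric])
  have "E \<noteq> 0" by (auto simp: E_def fun_eq_iff)
  then have pos: "0 < nrm E" using nrm_nonneg[OF EA] nrm_eq_0_iff[OF EA] by linarith
  show ?thesis
  proof (intro exI ballI)
    fix M assume "M \<in> \<A>"
    then have "cmod (M i j) * nrm E \<le> nrm M" using E[of M] nrm_scale[OF EA, of "M i j"] by simp
    then show "cmod (M i j) \<le> inverse (nrm E) * nrm M"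
      using pos by (simp add: field_simps)
  qed
qed

text \<open>These are exactly the matrices of matrices with finite
  \<open>block_norm\<close>.\<close>

definition block_space :: "('i \<Rightarrow> 'i \<Rightarrow> 'k cmatrix) set"
  where "block_space = {B. (\<forall>i j. ell2_bounded (B i j)) \<and> norm_matrix B \<in> \<A>}"

text \<open>Operator norms are least bounds, so \<open>norm_matrix B\<close> is dominated entrywise
  by \<open>M\<close> and solidity applies. The closure properties below rest on this lemma, each
  with its own \<open>M\<close>.\<close>

lemma block_spaceI:
  assumes "\<And>i j. bilinear_bound (B i j) (c i j)" "M \<in> \<A>" "\<And>i j. c i j \<le> cmod (M i j)"
  shows "B \<in> block_space" and "nrm (norm_matrix B) \<le> nrm M"
proof -
  have b: "ell2_bounded (B i j)" for i j using assms(1) by (rule bilinear_bound_imp_ell2_bounded)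
  have le: "cmod (norm_matrix B i j) \<le> cmod (M i j)" for i j
    using bilinear_bound_nonneg[OF ell2_bounded_imp_bilinear_bound[OF b[of i j]]]
      ell2_opnorm_le[OF assms(1), of i j] assms(3)[of i j]
    by (simp add: norm_matrix_def)
  show "B \<in> block_space" and "nrm (norm_matrix B) \<le> nrm M"
    using b solid_closed[OF assms(2) le] solid_nrm[OF assms(2) le] by (auto simp: block_space_def)
qed

lemma block_spaceD:
  assumes "B \<in> block_space"
  shows "bilinear_bound (B i j) (ell2_opnorm (B i j))" and "0 \<le> ell2_opnorm (B i j)"
    and "norm_matrix B \<in> \<A>"
proof -
  show b: "bilinear_bound (B i j) (ell2_opnorm (B i j))"
    using assms by (auto simp: block_space_def intro: ell2_bounded_imp_bilinear_bound)
  show "0 \<le> ell2_opnorm (B i j)" using b by (rule bilinear_bound_nonneg)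
  show "norm_matrix B \<in> \<A>" using assms by (simp add: block_space_def)
qed

lemma block_space_add:
  assumes "B \<in> block_space" "C \<in> block_space"
  shows "(\<lambda>i j k l. B i j k l + C i j k l) \<in> block_space"
    and "nrm (norm_matrix (\<lambda>i j k l. B i j k l + C i j k l)) \<le> nrm (norm_matrix B) + nrm (norm_matrix C)"
proof -
  note D = block_spaceD[OF assms(1)] block_spaceD[OF assms(2)]
  have sum: "norm_matrix B + norm_matrix C \<in> \<A>" using D subspace_carrier by (simp add: subspace_add)
  have le: "ell2_opnorm (B i j) + ell2_opnorm (C i j) \<le> cmod ((norm_matrix B + norm_matrix C) i j)" for i j
    using D(2)[of i j] D(5)[of i j] by (simp add: norm_matrix_def flip: of_real_add)
  from block_spaceI[OF bilinear_bound_add[OF D(1) D(4)] sum le]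
  show "(\<lambda>i j k l. B i j k l + C i j k l) \<in> block_space"
    and "nrm (norm_matrix (\<lambda>i j k l. B i j k l + C i j k l)) \<le> nrm (norm_matrix B) + nrm (norm_matrix C)"
    using nrm_triangle[OF D(3) D(6)] by (blast intro: order_trans)+
qed

lemma block_space_0:
  shows "(\<lambda>i j k l. 0) \<in> block_space" and "nrm (norm_matrix (\<lambda>i j k l. 0)) = 0"
proof -
  have "0 \<in> \<A>" using subspace_carrier by (rule subspace_0)
  note * = block_spaceI[OF bilinear_bound_0 this norm_ge_zero]
  show "(\<lambda>i j k l. 0) \<in> block_space" by (rule *)
  show "nrm (norm_matrix (\<lambda>i j k l. 0)) = 0"
    using *(2) nrm_eq_0_iff[OF \<open>0 \<in> \<A>\<close>] nrm_nonneg[OF block_spaceD(3)[OF *(1)]]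
    by (intro order.antisym) simp_all
qed

lemma block_nrm_eq_0_iff:
  assumes "B \<in> block_space"
  shows "nrm (norm_matrix B) = 0 \<longleftrightarrow> B = (\<lambda>i j k l. 0)"
proof
  assume "nrm (norm_matrix B) = 0"
  then have "norm_matrix B = 0" using nrm_eq_0_iff block_spaceD(3)[OF assms] by blast
  then have "ell2_opnorm (B i j) = 0" for i j by (auto simp: norm_matrix_def fun_eq_iff)
  then have "B i j k l = 0" for i j k l
    using bilinear_bound_entry[OF block_spaceD(1)[OF assms], of i j k l] by simp
  then show "B = (\<lambda>i j k l. 0)" by (simp add: fun_eq_iff)
qed (simp add: block_space_0)

lemma block_space_scale_le:
  assumes "B \<in> block_space"
  shows "(\<lambda>i j k l. c * B i j k l) \<in> block_space"
    and "nrm (norm_matrix (\<lambda>i j k l. c * B i j k l)) \<le> cmod c * nrm (norm_matrix B)"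
proof -
  note D = block_spaceD[OF assms]
  have "mat_scale c (norm_matrix B) \<in> \<A>" using D subspace_carrier by (simp add: subspace_scale)
  from block_spaceI[OF bilinear_bound_scale[OF D(1)] this]
  show "(\<lambda>i j k l. c * B i j k l) \<in> block_space"
    and "nrm (norm_matrix (\<lambda>i j k l. c * B i j k l)) \<le> cmod c * nrm (norm_matrix B)"
    using D nrm_scale[of "norm_matrix B" c]
    by (auto simp: norm_matrix_def mat_scale_def norm_mult)
qed

text \<open>The reverse inequality is the one already known, applied to scaling back by
  \<open>inverse c\<close>.\<close>

lemma block_space_scale:
  assumes "B \<in> block_space"
  shows "nrm (norm_matrix (\<lambda>i j k l. c * B i j k l)) = cmod c * nrm (norm_matrix B)"
proof (cases "c = 0")
  case True
  then show ?thesis by (simp add: block_space_0)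
next
  case False
  have "nrm (norm_matrix B) \<le> cmod (inverse c) * nrm (norm_matrix (\<lambda>i j k l. c * B i j k l))"
    using block_space_scale_le(2)[OF block_space_scale_le(1)[OF assms], of "inverse c" c] False
    by (simp add: mult.assoc[symmetric])
  then have "cmod c * nrm (norm_matrix B) \<le> nrm (norm_matrix (\<lambda>i j k l. c * B i j k l))"
    using False by (simp add: norm_divide field_simps)
  then show ?thesis using block_space_scale_le(2)[OF assms, of c] by simp
qed

lemma block_space_diff:
  assumes "B \<in> block_space" "C \<in> block_space"
  shows "(\<lambda>i j k l. B i j k l - C i j k l) \<in> block_space"
  using block_space_add(1)[OF assms(1) block_space_scale_le(1)[OF assms(2), of "-1"]] by simp

lemma block_space_adjoint_le:
  assumes "B \<in> block_space"
  shows "(\<lambda>i j. mat_adjoint (B j i)) \<in> block_space"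
    and "nrm (norm_matrix (\<lambda>i j. mat_adjoint (B j i))) \<le> nrm (norm_matrix B)"
proof -
  note D = block_spaceD[OF assms]
  show "(\<lambda>i j. mat_adjoint (B j i)) \<in> block_space"
    and "nrm (norm_matrix (\<lambda>i j. mat_adjoint (B j i))) \<le> nrm (norm_matrix B)"
    using block_spaceI[OF bilinear_bound_adjoint[OF D(1)] mat_adjoint_closed[OF D(3)]]
      nrm_mat_adjoint[OF D(3)]
    by (auto simp: norm_matrix_def mat_adjoint_def)
qed

lemma block_space_adjoint:
  assumes "B \<in> block_space"
  shows "nrm (norm_matrix (\<lambda>i j. mat_adjoint (B j i))) = nrm (norm_matrix B)"
  using block_space_adjoint_le(2)[OF assms]
    block_space_adjoint_le(2)[OF block_space_adjoint_le(1)[OF assms]]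
  by (simp add: mat_adjoint_def)

section \<open>Multiplication of matrices of bounded matrices\<close>

text \<open>The series is an entry of the product of two members of \<open>\<A>\<close>, which
  converges by assumption. It is the scalar majorant for every series in a block product.\<close>

lemma opnorm_product_summable:
  assumes "B \<in> block_space" "C \<in> block_space"
  shows "(\<lambda>m. ell2_opnorm (B i m) * ell2_opnorm (C m j)) summable_on UNIV"
    and "mat_mult (norm_matrix B) (norm_matrix C) i j =
      complex_of_real (\<Sum>\<^sub>\<infinity>m. ell2_opnorm (B i m) * ell2_opnorm (C m j))"
proof -
  have "(\<lambda>m. complex_of_real (ell2_opnorm (B i m) * ell2_opnorm (C m j))) summable_on UNIV"
    using mat_mult_summable[OF block_spaceD(3)[OF assms(1)] block_spaceD(3)[OF assms(2)], of i j]
    by (simp add: norm_matrix_def)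
  from summable_on_Re[OF this]
  show s: "(\<lambda>m. ell2_opnorm (B i m) * ell2_opnorm (C m j)) summable_on UNIV" by simp
  show "mat_mult (norm_matrix B) (norm_matrix C) i j =
      complex_of_real (\<Sum>\<^sub>\<infinity>m. ell2_opnorm (B i m) * ell2_opnorm (C m j))"
    using infsumI[OF has_sum_of_real[OF has_sum_infsum[OF s], where 'a=complex]]
    by (simp add: mat_mult_def norm_matrix_def)
qed

lemma block_product_bound:
  assumes "B \<in> block_space" "C \<in> block_space"
  shows "bilinear_bound (mat_mult (B i m) (C m j)) (ell2_opnorm (B i m) * ell2_opnorm (C m j))"
  using assms by (intro bilinear_bound_mat_mult block_spaceD)

lemma block_mult_bound:
  assumes "B \<in> block_space" "C \<in> block_space"
  shows "bilinear_bound (block_mult B C i j) (\<Sum>\<^sub>\<infinity>m. ell2_opnorm (B i m) * ell2_opnorm (C m j))"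
  unfolding block_mult_def
  using block_product_bound[OF assms] opnorm_product_summable(1)[OF assms] by (rule bilinear_bound_infsum)

text \<open>The norm matrix of the product is dominated by the product of the norm matrices, so
  submultiplicativity is inherited from \<open>\<A>\<close>.\<close>

lemma block_mult_space:
  assumes "B \<in> block_space" "C \<in> block_space"
  shows "block_mult B C \<in> block_space"
    and "nrm (norm_matrix (block_mult B C)) \<le> nrm (norm_matrix B) * nrm (norm_matrix C)"
proof -
  note A = block_spaceD(3)[OF assms(1)] block_spaceD(3)[OF assms(2)]
  have le: "(\<Sum>\<^sub>\<infinity>m. ell2_opnorm (B i m) * ell2_opnorm (C m j)) \<le>
      cmod (mat_mult (norm_matrix B) (norm_matrix C) i j)" for i j
    by (simp add: opnorm_product_summable(2)[OF assms])
  note * = block_spaceI[OF block_mult_bound[OF assms] mat_mult_closed[OF A] le]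
  show "block_mult B C \<in> block_space" by (rule *)
  show "nrm (norm_matrix (block_mult B C)) \<le> nrm (norm_matrix B) * nrm (norm_matrix C)"
    using *(2) nrm_mat_mult[OF A] by linarith
qed

text \<open>The first two parts are the inner and the outer series of the block product. The third
  is joint summability, which later permits the two contractions to be exchanged; its majorant in
  \<open>m\<close> is the product of operator norms.\<close>

lemma block_mult_summable:
  assumes "B \<in> block_space" "C \<in> block_space"
  shows "(\<lambda>n. B i m k n * C m j n l) summable_on UNIV"
    and "(\<lambda>m. mat_mult (B i m) (C m j) k l) summable_on UNIV"
    and "(\<lambda>(m, n). B i m k n * C m j n l) summable_on UNIV \<times> UNIV"
proof -
  note D = block_spaceD(1)[OF assms(1)] block_spaceD(1)[OF assms(2)]
  show "(\<lambda>n. B i m k n * C m j n l) summable_on UNIV"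
    by (rule mat_mult_summable_bounded[OF D])
  show "(\<lambda>m. mat_mult (B i m) (C m j) k l) summable_on UNIV"
    by (rule bilinear_bound_summable[OF block_product_bound[OF assms] opnorm_product_summable(1)[OF assms]])
  show "(\<lambda>(m, n). B i m k n * C m j n l) summable_on UNIV \<times> UNIV"
    by (rule abs_summable_summable, rule abs_summable_on_prodI[OF _ _ opnorm_product_summable(1)[OF assms]])
      (auto intro: mat_mult_abs_summable[OF D])
qed

text \<open>The block sum is pulled out of the matrix product, the sums over the two block indices
  are exchanged, the triple products of bounded matrices are reassociated, and the sum is put back
  on the other side.\<close>

lemma block_mult_assoc:
  assumes "B \<in> block_space" "C \<in> block_space" "D \<in> block_space"
  shows "block_mult (block_mult B C) D = block_mult B (block_mult C D)"
proof (intro ext)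
  fix i j k l
  let ?t = "\<lambda>m p. mat_mult (mat_mult (B i p) (C p m)) (D m j) k l"
  let ?b = "\<lambda>m p. ell2_opnorm (B i p) * ell2_opnorm (C p m) * ell2_opnorm (D m j)"
  have t: "bilinear_bound (mat_mult (mat_mult (B i p) (C p m)) (D m j)) (?b m p)" for m p
    using assms by (intro bilinear_bound_mat_mult block_spaceD)
  \<comment> \<open>This is the series for an entry of the product of three norm matrices,
    convergent because \<open>\<A>\<close> is closed under multiplication.\<close>
  have "(\<lambda>m. \<Sum>\<^sub>\<infinity>p. ?b m p) summable_on UNIV"
  proof -
    have "(\<lambda>m. complex_of_real ((\<Sum>\<^sub>\<infinity>p. ell2_opnorm (B i p) * ell2_opnorm (C p m)) * ell2_opnorm (D m j)))
        summable_on UNIV"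
      using mat_mult_summable[OF mat_mult_closed[OF block_spaceD(3)[OF assms(1)] block_spaceD(3)[OF assms(2)]]
          block_spaceD(3)[OF assms(3)], of i j]
      by (simp add: opnorm_product_summable(2)[OF assms(1,2)]) (simp add: norm_matrix_def)
    from summable_on_Re[OF this] show ?thesis by (simp add: infsum_cmult_left')
  qed
  then have "(\<lambda>(m, p). ?t m p) abs_summable_on UNIV \<times> UNIV"
  proof (rule abs_summable_on_prodI[rotated 2])
    fix m
    have s: "?b m summable_on UNIV"
      by (intro summable_on_cmult_left opnorm_product_summable assms)
    show a: "(\<lambda>p. case (m, p) of (m, p) \<Rightarrow> ?t m p) abs_summable_on UNIV"
      using bilinear_bound_abs_summable[OF t s, of k l] by simp
    show "(\<Sum>\<^sub>\<infinity>p. cmod (case (m, p) of (m, p) \<Rightarrow> ?t m p)) \<le> (\<Sum>\<^sub>\<infinity>p. ?b m p)"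
      using infsum_mono[OF a s] bilinear_bound_entry[OF t] by simp
  qed
  then have sw: "(\<lambda>(m, p). ?t m p) summable_on UNIV \<times> UNIV"
    by (rule abs_summable_summable)
  have "block_mult (block_mult B C) D i j k l = (\<Sum>\<^sub>\<infinity>m. \<Sum>\<^sub>\<infinity>p. ?t m p)"
    unfolding block_mult_def
    by (intro infsum_cong mat_mult_infsum_left[OF block_product_bound[OF assms(1,2)]
          opnorm_product_summable(1)[OF assms(1,2)] block_spaceD(1)[OF assms(3)]])
  also have "\<dots> = (\<Sum>\<^sub>\<infinity>p. \<Sum>\<^sub>\<infinity>m. ?t m p)"
    by (rule infsum_swap_banach[OF sw])
  also have "\<dots> = (\<Sum>\<^sub>\<infinity>p. \<Sum>\<^sub>\<infinity>m. mat_mult (B i p) (mat_mult (C p m) (D m j)) k l)"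
    using assms by (simp add: mat_mult_assoc_bounded[OF block_spaceD(1) block_spaceD(1) block_spaceD(1)])
  also have "\<dots> = block_mult B (block_mult C D) i j k l"
    unfolding block_mult_def
    by (intro infsum_cong mat_mult_infsum_right[OF block_product_bound[OF assms(2,3)]
          opnorm_product_summable(1)[OF assms(2,3)] block_spaceD(1)[OF assms(1)], symmetric])
  finally show "block_mult (block_mult B C) D i j k l = block_mult B (block_mult C D) i j k l" .
qed

lemma block_mult_add_left:
  assumes "B \<in> block_space" "C \<in> block_space" "D \<in> block_space"
  shows "block_mult (\<lambda>i j k l. B i j k l + C i j k l) D i j k l =
    block_mult B D i j k l + block_mult C D i j k l"
proof -
  note s = block_mult_summable[OF assms(1,3)] block_mult_summable[OF assms(2,3)]
  have "mat_mult (\<lambda>k l. B i m k l + C i m k l) (D m j) k l =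
      mat_mult (B i m) (D m j) k l + mat_mult (C i m) (D m j) k l" for m
    by (simp add: mat_mult_def distrib_right infsum_add s)
  then show ?thesis by (simp add: block_mult_def infsum_add s)
qed

lemma block_mult_add_right:
  assumes "B \<in> block_space" "C \<in> block_space" "D \<in> block_space"
  shows "block_mult D (\<lambda>i j k l. B i j k l + C i j k l) i j k l =
    block_mult D B i j k l + block_mult D C i j k l"
proof -
  note s = block_mult_summable[OF assms(3,1)] block_mult_summable[OF assms(3,2)]
  have "mat_mult (D i m) (\<lambda>k l. B m j k l + C m j k l) k l =
      mat_mult (D i m) (B m j) k l + mat_mult (D i m) (C m j) k l" for m
    by (simp add: mat_mult_def distrib_left infsum_add s)
  then show ?thesis by (simp add: block_mult_def infsum_add s)
qed

section \<open>Completeness\<close>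

text \<open>The norm matrices form a Cauchy sequence in \<open>\<A>\<close>; the entries of its
  limit \<open>L\<close> bound the blocks of \<open>Z\<close>, so \<open>Z\<close> is controlled by
  \<open>L\<close>.\<close>

lemma block_space_pointwise_limit:
  assumes Y: "\<And>n::nat. Y n \<in> block_space"
    and Cauchy: "\<And>e. e > 0 \<Longrightarrow> \<exists>N. \<forall>m\<ge>N. \<forall>n\<ge>N. nrm (norm_matrix (\<lambda>i j k l. Y m i j k l - Y n i j k l)) < e"
    and lim: "\<And>i j k l. (\<lambda>n. Y n i j k l) \<longlonglongrightarrow> Z i j k l"
    and bound: "\<forall>\<^sub>F n in sequentially. nrm (norm_matrix (Y n)) \<le> c"
  shows "Z \<in> block_space" and "nrm (norm_matrix Z) \<le> c"
proof -
  let ?W = "\<lambda>n. norm_matrix (Y n)"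
  note W = block_spaceD(3)[OF Y]
  have opnorm_le: "ell2_opnorm (Y m i j) \<le>
      ell2_opnorm (Y n i j) + ell2_opnorm (\<lambda>k l. Y m i j k l - Y n i j k l)" for m n i j
    using ell2_opnorm_le[OF bilinear_bound_add[OF block_spaceD(1)[OF Y[of n], of i j]
        block_spaceD(1)[OF block_space_diff[OF Y[of m] Y[of n]], of i j]]] by simp
  have sym: "ell2_opnorm (\<lambda>k l. Y m i j k l - Y n i j k l) \<le> ell2_opnorm (\<lambda>k l. Y n i j k l - Y m i j k l)"
    for m n i j
    using ell2_opnorm_le[OF bilinear_bound_scale[OF
        block_spaceD(1)[OF block_space_diff[OF Y[of n] Y[of m]], of i j], of "-1"]] by simp
  \<comment> \<open>The reverse triangle inequality for operator norms holds in each block and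
    passes to \<open>nrm\<close> by solidity.\<close>
  have W_le: "nrm (?W m - ?W n) \<le> nrm (norm_matrix (\<lambda>i j k l. Y m i j k l - Y n i j k l))" for m n
  proof (rule solid_nrm)
    show "norm_matrix (\<lambda>i j k l. Y m i j k l - Y n i j k l) \<in> \<A>"
      by (rule block_spaceD(3)[OF block_space_diff[OF Y Y]])
    show "cmod ((?W m - ?W n) i j) \<le> cmod (norm_matrix (\<lambda>i j k l. Y m i j k l - Y n i j k l) i j)" for i j
      using opnorm_le[of m i j n] opnorm_le[of n i j m] sym[of n i j m]
      by (simp add: norm_matrix_def flip: of_real_diff)
  qed
  have "\<exists>L\<in>\<A>. (\<lambda>n. nrm (?W n - L)) \<longlonglongrightarrow> 0"
  proof (rule complete_carrier)
    fix e :: real assume "e > 0"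
    from Cauchy[OF this] show "\<exists>N. \<forall>m\<ge>N. \<forall>n\<ge>N. nrm (?W m - ?W n) < e"
      using W_le by (meson le_less_trans)
  qed (rule W)
  then obtain L where L: "L \<in> \<A>" and conv: "(\<lambda>n. nrm (?W n - L)) \<longlonglongrightarrow> 0" by blast
  have WL: "?W n - L \<in> \<A>" for n using W L subspace_carrier by (simp add: subspace_diff)
  \<comment> \<open>Convergence in \<open>nrm\<close> implies entrywise convergence by
    \<open>entry_bound\<close>; real parts are taken because \<open>L\<close> is a complex
    matrix.\<close>
  have entry: "(\<lambda>n. ell2_opnorm (Y n i j)) \<longlonglongrightarrow> Re (L i j)" for i j
  proof -
    obtain K where K: "\<And>M. M \<in> \<A> \<Longrightarrow> cmod (M i j) \<le> K * nrm M" using entry_bound by blast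
    have "(\<lambda>n. ?W n i j - L i j) \<longlonglongrightarrow> 0"
    proof (rule Lim_null_comparison)
      show "\<forall>\<^sub>F n in sequentially. cmod (?W n i j - L i j) \<le> K * nrm (?W n - L)"
        using K[OF WL] by simp
      show "(\<lambda>n. K * nrm (?W n - L)) \<longlonglongrightarrow> 0"
        using tendsto_mult_right_zero[OF conv] by simp
    qed
    from tendsto_Re[OF Lim_null[THEN iffD2, OF this]] show ?thesis by (simp add: norm_matrix_def)
  qed
  have Z: "bilinear_bound (Z i j) (Re (L i j))" for i j
    by (rule bilinear_bound_limit[where M="\<lambda>n. Y n i j", OF lim entry]) (simp_all add: block_spaceD(1)[OF Y])
  note Z' = block_spaceI[OF Z L complex_Re_le_cmod]
  show "Z \<in> block_space" by (rule Z')
  have "nrm L \<le> c"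
  proof (rule tendsto_lowerbound)
    show "(\<lambda>n. c + nrm (?W n - L)) \<longlonglongrightarrow> c" using tendsto_add[OF tendsto_const conv, of c] by simp
    show "\<forall>\<^sub>F n in sequentially. nrm L \<le> c + nrm (?W n - L)"
      using bound
    proof eventually_elim
      case (elim n)
      have "mat_scale (-1) (?W n - L) = L - ?W n" by (auto simp: mat_scale_def fun_eq_iff)
      then have "nrm (L - ?W n) = nrm (?W n - L)" and "L - ?W n \<in> \<A>"
        using nrm_scale[OF WL, of "-1" n] subspace_scale[OF subspace_carrier WL, of "-1" n] by simp_all
      with nrm_triangle[OF this(2) W[of n]] elim show ?case by simp
    qed
  qed simp
  with Z'(2) show "nrm (norm_matrix Z) \<le> c" by linarith
qed

text \<open>Entries are dominated by block norms and these by \<open>nrm\<close>, so a Cauchy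
  sequence has an entrywise limit. Entrywise convergence is part of the conclusion so that limits
  found in the two pictures of a tensor can be identified.\<close>

lemma block_space_complete:
  assumes X: "\<And>n::nat. X n \<in> block_space"
    and Cauchy: "\<And>e. e > 0 \<Longrightarrow> \<exists>N. \<forall>m\<ge>N. \<forall>n\<ge>N. nrm (norm_matrix (\<lambda>i j k l. X m i j k l - X n i j k l)) < e"
  shows "\<exists>Z\<in>block_space. (\<lambda>n. nrm (norm_matrix (\<lambda>i j k l. X n i j k l - Z i j k l))) \<longlonglongrightarrow> 0 \<and>
    (\<forall>i j k l. (\<lambda>n. X n i j k l) \<longlonglongrightarrow> Z i j k l)"
proof -
  let ?d = "\<lambda>m n i j k l. X m i j k l - X n i j k l"
  have d: "?d m n \<in> block_space" for m n by (rule block_space_diff[OF X X])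
  have "\<exists>z. (\<lambda>n. X n i j k l) \<longlonglongrightarrow> z" for i j k l
  proof -
    obtain K where K: "\<And>M. M \<in> \<A> \<Longrightarrow> cmod (M i j) \<le> K * nrm M" using entry_bound by blast
    have le: "cmod (X m i j k l - X n i j k l) \<le> \<bar>K\<bar> * nrm (norm_matrix (?d m n))" for m n
    proof -
      have "cmod (X m i j k l - X n i j k l) \<le> cmod (norm_matrix (?d m n) i j)"
        using bilinear_bound_entry[OF block_spaceD(1)[OF d[of m n]], of i j k l] by (simp add: norm_matrix_def)
      also have "\<dots> \<le> K * nrm (norm_matrix (?d m n))" by (rule K[OF block_spaceD(3)[OF d]])
      also have "\<dots> \<le> \<bar>K\<bar> * nrm (norm_matrix (?d m n))"
        by (intro mult_right_mono nrm_nonneg block_spaceD(3)[OF d]) simp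
      finally show ?thesis .
    qed
    have "Cauchy (\<lambda>n. X n i j k l)"
    proof (rule metric_CauchyI)
      fix e :: real assume "e > 0"
      then have "e / (\<bar>K\<bar> + 1) > 0" by simp
      from Cauchy[OF this] obtain N where N: "\<And>m n. m \<ge> N \<Longrightarrow> n \<ge> N \<Longrightarrow>
          nrm (norm_matrix (?d m n)) < e / (\<bar>K\<bar> + 1)" by blast
      show "\<exists>N. \<forall>m\<ge>N. \<forall>n\<ge>N. dist (X m i j k l) (X n i j k l) < e"
      proof (intro exI allI impI)
        fix m n assume mn: "N \<le> m" "N \<le> n"
        have "cmod (X m i j k l - X n i j k l) \<le> (\<bar>K\<bar> + 1) * nrm (norm_matrix (?d m n))"
          using le[of m n] nrm_nonneg[OF block_spaceD(3)[OF d[of m n]]] by (simp add: distrib_right)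
        also have "\<dots> < e" using N[OF mn] by (simp add: field_simps add_pos_nonneg pos_less_divide_eq)
        finally show "dist (X m i j k l) (X n i j k l) < e" by (simp add: dist_norm)
      qed
    qed
    then show ?thesis by (simp add: Cauchy_convergent_iff convergent_def)
  qed
  then obtain Z where Z: "\<And>i j k l. (\<lambda>n. X n i j k l) \<longlonglongrightarrow> Z i j k l" by metis
  \<comment> \<open>With \<open>n\<close> fixed, \<open>m\<close> tends to infinity in
    \<open>?d m n\<close>. The fixed term cancels in differences, so this sequence is again
    Cauchy.\<close>
  have lim: "(\<lambda>i j k l. Z i j k l - X n i j k l) \<in> block_space \<and>
      nrm (norm_matrix (\<lambda>i j k l. Z i j k l - X n i j k l)) \<le> e"
    if N: "\<forall>m\<ge>N. nrm (norm_matrix (?d m n)) < e" for n N e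
  proof -
    have "\<forall>\<^sub>F m in sequentially. nrm (norm_matrix (?d m n)) \<le> e"
      using N by (intro eventually_sequentiallyI[of N] less_imp_le) blast
    moreover have "(\<lambda>m. ?d m n i j k l) \<longlonglongrightarrow> Z i j k l - X n i j k l" for i j k l
      by (intro tendsto_intros Z)
    moreover have "\<exists>N. \<forall>m\<ge>N. \<forall>m'\<ge>N. nrm (norm_matrix (\<lambda>i j k l. ?d m n i j k l - ?d m' n i j k l)) < e"
      if "e > 0" for e using Cauchy[OF that] by simp
    ultimately show ?thesis
      using block_space_pointwise_limit[of "\<lambda>m. ?d m n" "\<lambda>i j k l. Z i j k l - X n i j k l" e] d by blast
  qed
  \<comment> \<open>\<open>Z\<close> belongs to the space as the sum of \<open>Z - X N1\<close> and
    \<open>X N1\<close>.\<close>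
  obtain N1 where "\<forall>m\<ge>N1. nrm (norm_matrix (?d m N1)) < 1" using Cauchy[of 1] by auto
  from block_space_add(1)[OF lim[OF this, THEN conjunct1] X[of N1]]
  have ZS: "Z \<in> block_space" by simp
  have "(\<lambda>n. nrm (norm_matrix (\<lambda>i j k l. X n i j k l - Z i j k l))) \<longlonglongrightarrow> 0"
  proof (rule LIMSEQ_I)
    fix e :: real assume "e > 0"
    then obtain N where N: "\<forall>m\<ge>N. \<forall>n\<ge>N. nrm (norm_matrix (?d m n)) < e / 2"
      using Cauchy[of "e / 2"] by auto
    have "norm (nrm (norm_matrix (\<lambda>i j k l. X n i j k l - Z i j k l)) - 0) < e" if "n \<ge> N" for n
    proof -
      note l = lim[of N n "e / 2"]
      have "nrm (norm_matrix (\<lambda>i j k l. X n i j k l - Z i j k l)) =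
          nrm (norm_matrix (\<lambda>i j k l. Z i j k l - X n i j k l))"
        using block_space_scale[OF block_space_diff[OF ZS X[of n]], of "-1"] by simp
      with l N that \<open>e > 0\<close> nrm_nonneg[OF block_spaceD(3)[OF block_space_diff[OF X[of n] ZS]]]
      show ?thesis by simp
    qed
    then show "\<exists>N. \<forall>n\<ge>N. norm (nrm (norm_matrix (\<lambda>i j k l. X n i j k l - Z i j k l)) - 0) < e" by blast
  qed
  with ZS Z show ?thesis by blast
qed

end


section \<open>The algebra of tensors\<close>

theorem proposition3p6:
  fixes \<A>\<^sub>1 :: "('i::countable) cmatrix set" and nrm\<^sub>1 :: "'i cmatrix \<Rightarrow> real"
    and \<A>\<^sub>2 :: "('k::countable) cmatrix set" and nrm\<^sub>2 :: "'k cmatrix \<Rightarrow> real"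
    and \<A> :: "('i, 'k) tensor4 set"
  assumes "solid_involutive_banach_matrix_algebra \<A>\<^sub>1 nrm\<^sub>1"
    and "solid_involutive_banach_matrix_algebra \<A>\<^sub>2 nrm\<^sub>2"
    and "\<A> = tensor_space1 \<A>\<^sub>1 nrm\<^sub>1 \<inter> tensor_space2 \<A>\<^sub>2 nrm\<^sub>2"
  shows "(\<forall>A\<in>\<A>. \<forall>B\<in>\<A>. double_contraction_converges A B) \<and>
    involutive_banach_algebra_on tensor_scale \<A> (tensor_norm \<A>\<^sub>1 nrm\<^sub>1 \<A>\<^sub>2 nrm\<^sub>2)
      double_contraction tensor_adjoint"
proof -
  interpret S1: solid_involutive_banach_matrix_algebra \<A>\<^sub>1 nrm\<^sub>1 by (rule assms(1))
  interpret S2: solid_involutive_banach_matrix_algebra \<A>\<^sub>2 nrm\<^sub>2 by (rule assms(2))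
  interpret T: vector_space "tensor_scale :: complex \<Rightarrow> ('i, 'k) tensor4 \<Rightarrow> _"
    by (rule vector_space_tensor_scale)
  \<comment> \<open>The two pictures of a tensor: \<open>u\<close> has blocks indexed by
    \<open>(i, j)\<close>, \<open>v\<close> has blocks indexed by \<open>(k, l)\<close>.\<close>
  define u :: "('i, 'k) tensor4 \<Rightarrow> 'i \<Rightarrow> 'i \<Rightarrow> 'k cmatrix" where "u A = (\<lambda>i j k l. A i k l j)" for A
  define v :: "('i, 'k) tensor4 \<Rightarrow> 'k \<Rightarrow> 'k \<Rightarrow> 'i cmatrix" where "v A = (\<lambda>k l i j. A i k l j)" for A
  define p where "p A = nrm\<^sub>1 (norm_matrix (u A))" for A
  define q where "q A = nrm\<^sub>2 (norm_matrix (v A))" for A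
  have n1: "tensor_norm1 \<A>\<^sub>1 nrm\<^sub>1 A = (if u A \<in> S1.block_space then ereal (p A) else \<infinity>)" for A
    by (simp add: tensor_norm1_def block_norm_def S1.block_space_def u_def p_def norm_matrix_def)
  have n2: "tensor_norm2 \<A>\<^sub>2 nrm\<^sub>2 A = (if v A \<in> S2.block_space then ereal (q A) else \<infinity>)" for A
    by (simp add: tensor_norm2_def block_norm_def S2.block_space_def v_def q_def norm_matrix_def)
  have mem: "A \<in> \<A> \<longleftrightarrow> u A \<in> S1.block_space \<and> v A \<in> S2.block_space" for A
    by (simp add: assms(3) tensor_space1_def tensor_space2_def n1 n2)
  define N where "N = tensor_norm \<A>\<^sub>1 nrm\<^sub>1 \<A>\<^sub>2 nrm\<^sub>2"
  have N: "N A = max (p A) (q A)" if "A \<in> \<A>" for A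
    using that by (simp add: mem N_def tensor_norm_def n1 n2 flip: ereal_max)
  have p_nonneg: "0 \<le> p A" and q_nonneg: "0 \<le> q A" if "A \<in> \<A>" for A
    using that S1.nrm_nonneg[OF S1.block_spaceD(3)] S2.nrm_nonneg[OF S2.block_spaceD(3)]
    by (auto simp: mem p_def q_def)

  have u_add: "u (A + B) = (\<lambda>i j k l. u A i j k l + u B i j k l)"
    and v_add: "v (A + B) = (\<lambda>k l i j. v A k l i j + v B k l i j)"
    and u_scale: "u (tensor_scale c A) = (\<lambda>i j k l. c * u A i j k l)"
    and v_scale: "v (tensor_scale c A) = (\<lambda>k l i j. c * v A k l i j)"
    and u_diff: "u (A - B) = (\<lambda>i j k l. u A i j k l - u B i j k l)"
    and v_diff: "v (A - B) = (\<lambda>k l i j. v A k l i j - v B k l i j)"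
    and u_adj: "u (tensor_adjoint A) = (\<lambda>i j. mat_adjoint (u A j i))"
    and v_adj: "v (tensor_adjoint A) = (\<lambda>k l. mat_adjoint (v A l k))"
    and u_0: "u 0 = (\<lambda>i j k l. 0)" and v_0: "v 0 = (\<lambda>k l i j. 0)" for A B c
    by (simp_all add: u_def v_def tensor_scale_def tensor_adjoint_def mat_adjoint_def
        plus_fun_def zero_fun_def fun_diff_def)
  \<comment> \<open>The outer contraction index \<open>n\<close> is the block index of this picture,
    so both sides sum in the same order.\<close>
  have v_mult: "v (double_contraction A B) = block_mult (v A) (v B)" for A B
    by (simp add: v_def double_contraction_def block_mult_def mat_mult_def)
  \<comment> \<open>Here the block index is the inner index \<open>m\<close>, so the sums must be
    exchanged; the joint summability comes from the other picture.\<close>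
  have u_mult: "u (double_contraction A B) = block_mult (u A) (u B)" if "A \<in> \<A>" "B \<in> \<A>" for A B
  proof (intro ext)
    fix i j k l
    have "v A \<in> S2.block_space" "v B \<in> S2.block_space" using that mem by blast+
    from infsum_swap_banach[OF S2.block_mult_summable(3)[OF this, of k i l j]]
    show "u (double_contraction A B) i j k l = block_mult (u A) (u B) i j k l"
      by (simp add: u_def v_def double_contraction_def block_mult_def mat_mult_def)
  qed
  \<comment> \<open>Since \<open>v\<close> only permutes arguments, algebraic identities may be
    verified in the \<open>(k, l)\<close> picture alone.\<close>
  have v_inj: "A = B" if "v A = v B" for A B
    using that by (auto simp: v_def fun_eq_iff)

  have add_closed: "A + B \<in> \<A>" and N_add: "N (A + B) \<le> N A + N B" if AB: "A \<in> \<A>" "B \<in> \<A>" for A B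
  proof -
    show "A + B \<in> \<A>"
      using AB S1.block_space_add(1)[of "u A" "u B"] S2.block_space_add(1)[of "v A" "v B"]
      by (simp add: mem u_add v_add)
    moreover have "p (A + B) \<le> p A + p B" "q (A + B) \<le> q A + q B"
      using AB S1.block_space_add(2)[of "u A" "u B"] S2.block_space_add(2)[of "v A" "v B"]
      by (simp_all add: mem p_def q_def u_add v_add)
    ultimately show "N (A + B) \<le> N A + N B" using AB by (auto simp: N max_def)
  qed
  have scale_closed: "tensor_scale c A \<in> \<A>"
    and N_scale: "N (tensor_scale c A) = cmod c * N A" if A: "A \<in> \<A>" for A c
  proof -
    show "tensor_scale c A \<in> \<A>"
      using A S1.block_space_scale_le(1)[of "u A"] S2.block_space_scale_le(1)[of "v A"]
      by (simp add: mem u_scale v_scale)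
    moreover have "p (tensor_scale c A) = cmod c * p A" "q (tensor_scale c A) = cmod c * q A"
      using A S1.block_space_scale[of "u A"] S2.block_space_scale[of "v A"]
      by (simp_all add: mem p_def q_def u_scale v_scale)
    ultimately show "N (tensor_scale c A) = cmod c * N A"
      using A by (simp add: N max_mult_distrib_left)
  qed
  have zero: "0 \<in> \<A>" using S1.block_space_0 S2.block_space_0 by (simp add: mem u_0 v_0)
  have diff_closed: "A - B \<in> \<A>" if "A \<in> \<A>" "B \<in> \<A>" for A B
    using that S1.block_space_diff[of "u A" "u B"] S2.block_space_diff[of "v A" "v B"]
    by (simp add: mem u_diff v_diff)
  have N_eq_0: "N A = 0 \<longleftrightarrow> A = 0" if A: "A \<in> \<A>" for A
  proof
    assume "N A = 0"
    then have "q A = 0" using q_nonneg[OF A] by (simp add: N[OF A] max_def split: if_splits)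
    then show "A = 0"
      using A S2.block_nrm_eq_0_iff[of "v A"] v_inj[of A 0] by (simp add: mem q_def v_0)
  next
    assume "A = 0"
    then show "N A = 0"
      by (simp add: N[OF zero] p_def q_def u_0 v_0 S1.block_space_0(2) S2.block_space_0(2))
  qed
  have mult_closed: "double_contraction A B \<in> \<A>"
    and N_mult: "N (double_contraction A B) \<le> N A * N B" if AB: "A \<in> \<A>" "B \<in> \<A>" for A B
  proof -
    show AB': "double_contraction A B \<in> \<A>"
      using AB S1.block_mult_space(1)[of "u A" "u B"] S2.block_mult_space(1)[of "v A" "v B"]
      by (simp add: mem u_mult v_mult)
    have "p (double_contraction A B) \<le> p A * p B" "q (double_contraction A B) \<le> q A * q B"
      using S1.block_mult_space(2)[of "u A" "u B"] S2.block_mult_space(2)[of "v A" "v B"] AB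
      unfolding p_def q_def u_mult[OF AB] v_mult mem by blast+
    moreover have "p A * p B \<le> N A * N B" "q A * q B \<le> N A * N B"
      using AB p_nonneg q_nonneg by (auto simp: N le_max_iff_disj intro!: mult_mono)
    ultimately show "N (double_contraction A B) \<le> N A * N B" by (simp add: N[OF AB'])
  qed
  have adj_closed: "tensor_adjoint A \<in> \<A>" and N_adj: "N (tensor_adjoint A) = N A" if A: "A \<in> \<A>" for A
  proof -
    show "tensor_adjoint A \<in> \<A>"
      using A S1.block_space_adjoint_le(1)[of "u A"] S2.block_space_adjoint_le(1)[of "v A"]
      by (simp add: mem u_adj v_adj)
    moreover have "p (tensor_adjoint A) = p A" "q (tensor_adjoint A) = q A"
      using A S1.block_space_adjoint[of "u A"] S2.block_space_adjoint[of "v A"]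
      by (simp_all add: mem p_def q_def u_adj v_adj)
    ultimately show "N (tensor_adjoint A) = N A" using A by (simp add: N)
  qed

  have complete: "\<exists>L\<in>\<A>. (\<lambda>n. N (X n - L)) \<longlonglongrightarrow> 0"
    if X: "\<And>n::nat. X n \<in> \<A>" and Cauchy: "\<And>e. e > 0 \<Longrightarrow> \<exists>M. \<forall>m\<ge>M. \<forall>n\<ge>M. N (X m - X n) < e" for X
  proof -
    have pq: "p (X m - X n) \<le> N (X m - X n)" "q (X m - X n) \<le> N (X m - X n)" for m n
      by (simp_all add: N diff_closed X)
    have "\<exists>M. \<forall>m\<ge>M. \<forall>n\<ge>M. p (X m - X n) < e" if "e > 0" for e
      using Cauchy[OF that] pq(1) by (meson le_less_trans)
    moreover have "u (X n) \<in> S1.block_space" for n using X mem by blast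
    ultimately obtain U where U: "U \<in> S1.block_space"
        "(\<lambda>n. nrm\<^sub>1 (norm_matrix (\<lambda>i j k l. u (X n) i j k l - U i j k l))) \<longlonglongrightarrow> 0"
        "\<And>i j k l. (\<lambda>n. u (X n) i j k l) \<longlonglongrightarrow> U i j k l"
      using S1.block_space_complete[of "\<lambda>n. u (X n)"] unfolding p_def u_diff by blast
    have "\<exists>M. \<forall>m\<ge>M. \<forall>n\<ge>M. q (X m - X n) < e" if "e > 0" for e
      using Cauchy[OF that] pq(2) by (meson le_less_trans)
    moreover have "v (X n) \<in> S2.block_space" for n using X mem by blast
    ultimately obtain V where V: "V \<in> S2.block_space"
        "(\<lambda>n. nrm\<^sub>2 (norm_matrix (\<lambda>k l i j. v (X n) k l i j - V k l i j))) \<longlonglongrightarrow> 0"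
        "\<And>k l i j. (\<lambda>n. v (X n) k l i j) \<longlonglongrightarrow> V k l i j"
      using S2.block_space_complete[of "\<lambda>n. v (X n)"] unfolding q_def v_diff by blast
    \<comment> \<open>The candidate limit is read off from the \<open>(i, j)\<close> picture.
      Uniqueness of entrywise limits shows that \<open>V\<close> describes the same tensor.\<close>
    define L where "L = (\<lambda>i k l j. U i j k l)"
    have uL: "u L = U" by (simp add: u_def L_def)
    have "V k l i j = U i j k l" for i j k l
      using LIMSEQ_unique[OF V(3)[of k l i j]] U(3)[of i j k l] by (simp add: u_def v_def)
    then have vL: "v L = V" by (simp add: v_def L_def fun_eq_iff)
    have L: "L \<in> \<A>" using U(1) V(1) by (simp add: mem uL vL)
    have "(\<lambda>n. max (p (X n - L)) (q (X n - L))) \<longlonglongrightarrow> max 0 0"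
      using U(2) V(2) by (intro tendsto_max) (simp_all add: p_def q_def u_diff v_diff uL vL)
    then have "(\<lambda>n. N (X n - L)) \<longlonglongrightarrow> 0" by (simp add: N diff_closed X L)
    with L show ?thesis by blast
  qed

  \<comment> \<open>In the \<open>(k, l)\<close> picture the inner and outer series of the block
    product are the required ones, in the required order.\<close>
  have converges: "double_contraction_converges A B" if "A \<in> \<A>" "B \<in> \<A>" for A B
    using S2.block_mult_summable(1,2)[of "v A" "v B"] that
    by (auto simp: double_contraction_converges_def mem v_def mat_mult_def)

  have "involutive_banach_algebra_on tensor_scale \<A> N double_contraction tensor_adjoint"
  proof
    show "T.subspace \<A>" using zero add_closed scale_closed by (simp add: T.subspace_def)
  next
    fix A B C :: "('i, 'k) tensor4" assume A: "A \<in> \<A>" and B: "B \<in> \<A>" and C: "C \<in> \<A>"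
    then have v: "v A \<in> S2.block_space" "v B \<in> S2.block_space" "v C \<in> S2.block_space" by (simp_all add: mem)
    show "double_contraction (double_contraction A B) C = double_contraction A (double_contraction B C)"
      by (rule v_inj) (simp add: v_mult S2.block_mult_assoc v)
    show "double_contraction (A + B) C = double_contraction A C + double_contraction B C"
      by (rule v_inj) (auto simp: v_mult v_add S2.block_mult_add_left v fun_eq_iff)
    show "double_contraction A (B + C) = double_contraction A B + double_contraction A C"
      by (rule v_inj) (auto simp: v_mult v_add S2.block_mult_add_right v fun_eq_iff)
  next
    \<comment> \<open>Scaling and conjugation commute with \<open>infsum\<close> even where it takes
      its default value 0, so these identities hold for arbitrary tensors.\<close>
    fix A B :: "('i, 'k) tensor4" and c :: complex
    show "double_contraction (tensor_scale c A) B = tensor_scale c (double_contraction A B)"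
      and "double_contraction A (tensor_scale c B) = tensor_scale c (double_contraction A B)"
      by (simp_all add: double_contraction_def tensor_scale_def mult.assoc mult.left_commute[of _ c]
          infsum_cmult_right')
    show "tensor_adjoint (double_contraction A B) = double_contraction (tensor_adjoint B) (tensor_adjoint A)"
      by (simp add: double_contraction_def tensor_adjoint_def mult.commute flip: infsum_cnj)
    show "tensor_adjoint (tensor_adjoint A) = A"
      and "tensor_adjoint (A + B) = tensor_adjoint A + tensor_adjoint B"
      and "tensor_adjoint (tensor_scale c A) = tensor_scale (cnj c) (tensor_adjoint A)"
      by (simp_all add: tensor_adjoint_def tensor_scale_def fun_eq_iff)
  next
    fix A assume "A \<in> \<A>"
    then show "0 \<le> N A" using p_nonneg by (simp add: N le_max_iff_disj)
  qed (fact N_eq_0 N_add N_scale complete mult_closed N_mult adj_closed N_adj)+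
  with converges show ?thesis by (simp add: N_def)
qed

end
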